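(* Let $X$ be a Banach function space on $[0,1]$, with norm dual $X^*$ and associate space $X'$. The following are equivalent: (1) $X$ has the order Banach-Saks property ($oBSP$). (2) $X$ is monotonically complete, $X^*$ is order continuous, and $X$ has the $X'$-order Banach-Saks property ($X'$-$oBSP$). (3) $X$ is monotonically complete, $X'$ is order continuous, and $X$ has the $X'$-order Banach-Saks property ($X'$-$oBSP$).
   Context: $L^0$ is the vector lattice of real measurable functions on $[0,1]$ (Lebesgue measure), modulo a.e. equality; inequalities are a.e. A Banach function space $X$ on $[0,1]$ is a Banach space that is a linear subspace of $L^0$ such that $f\in X$ and $\|f\|_X\le\|g\|_X$ whenever $f \in L^0$, $g\in X$ and $|f|\le|g|$. $X_+=\{f\in X: f\ge 0\}$. The associate space $X'$ is the space of all $g\in L^0$ with $\int_0^1|fg|\,dt<\infty$ for all $f\in X$; via $f\mapsto\int_0^1 fg\,dt$ it is identified with the order continuous dual of $X$ (the functionals $\varphi$ on $X$ with $\varphi(f_n)\to 0$ whenever $f_n$ order converges to $0$), and it carries the dual norm; functions inducing the same functional are identified. A sequence $\{f_n\}$ is $\sigma(X,X')$-null if $\int_0^1 f_ng\,dt\to0$ for every $g\in X'$. A sequence $\{f_n\}$ in $X$ order converges to $f\in X$ if there is a sequence $\{g_n\}$ in $X$ with $g_n\downarrow0$ and $|f_n-f|\le g_n$ for all $n$; equivalently, $f_n\to f$ a.e. and there is $h\in X_+$ with $|f_n|\le h$ for all $n$. The Cesàro sequence of $\{f_n\}$ is $\{\frac1m\sum_{n=1}^m f_n\}_m$. $X$ has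 $oBSP$ if every norm bounded sequence in $X$ has a subsequence whose Cesàro sequence order converges in $X$. $X$ has $X'$-$oBSP$ if every $\sigma(X,X')$-null norm bounded sequence in $X$ has a subsequence whose Cesàro sequence order converges in $X$. $X$ is monotonically complete if the pointwise supremum of any increasing, norm bounded sequence in $X_+$ belongs to $X$. A Banach lattice $E$ (such as $X^*$ or $X'$) is order continuous if $\|x_\alpha\|\to0$ for every net $x_\alpha\downarrow0$ in $E$; for a Banach function space this is equivalent to $\|f_n\|\to0$ for every sequence $\{f_n\}$ that order converges to $0$. *)

theory Defs
  imports "HOL-Analysis.Analysis"
begin

text \<open>
  Elements of \<open>L\<^sup>0\<close> are represented by Lebesgue measurable functions on the unit interval
  (values outside it are irrelevant). The a.e. quotient is not formed: all relations
  between functions are a.e. relations, and the spaces below are closed under a.e. equality.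
\<close>

abbreviation unit_leb :: "real measure" where
  "unit_leb \<equiv> lebesgue_on {0..1}"

definition ae_le :: "(real \<Rightarrow> real) \<Rightarrow> (real \<Rightarrow> real) \<Rightarrow> bool" where
  "ae_le f g \<longleftrightarrow> (AE t in unit_leb. f t \<le> g t)"

text \<open>
  Axiom \<open>solid\<close>, with \<open>norm_mono\<close>, also makes \<open>X\<close> and \<open>N\<close> invariant under a.e. equality.
  No assumption is made on the support of \<open>X\<close>.
\<close>

locale banach_function_space =
  fixes X :: "(real \<Rightarrow> real) set" and N :: "(real \<Rightarrow> real) \<Rightarrow> real"
  assumes measurable: "X \<subseteq> borel_measurable unit_leb"
    and zero_mem: "(\<lambda>t. 0) \<in> X"
    and add_mem: "\<And>f g. f \<in> X \<Longrightarrow> g \<in> X \<Longrightarrow> (\<lambda>t. f t + g t) \<in> X"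
    and scale_mem: "\<And>c f. f \<in> X \<Longrightarrow> (\<lambda>t. c * f t) \<in> X"
    and norm_nonneg: "\<And>f. f \<in> X \<Longrightarrow> 0 \<le> N f"
    and norm_eq_0: "\<And>f. f \<in> X \<Longrightarrow> N f = 0 \<longleftrightarrow> (AE t in unit_leb. f t = 0)"
    and norm_triangle: "\<And>f g. f \<in> X \<Longrightarrow> g \<in> X \<Longrightarrow> N (\<lambda>t. f t + g t) \<le> N f + N g"
    and norm_scale: "\<And>c f. f \<in> X \<Longrightarrow> N (\<lambda>t. c * f t) = \<bar>c\<bar> * N f"
    and complete: "\<And>f. (\<forall>n::nat. f n \<in> X) \<Longrightarrow>
          (\<forall>e>0. \<exists>k. \<forall>m\<ge>k. \<forall>n\<ge>k. N (\<lambda>t. f m t - f n t) < e) \<Longrightarrow>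
          (\<exists>l\<in>X. (\<lambda>n. N (\<lambda>t. f n t - l t)) \<longlonglongrightarrow> 0)"
    and solid: "\<And>f g. f \<in> borel_measurable unit_leb \<Longrightarrow> g \<in> X \<Longrightarrow>
          ae_le (\<lambda>t. \<bar>f t\<bar>) (\<lambda>t. \<bar>g t\<bar>) \<Longrightarrow> f \<in> X"
    and norm_mono: "\<And>f g. f \<in> borel_measurable unit_leb \<Longrightarrow> g \<in> X \<Longrightarrow>
          ae_le (\<lambda>t. \<bar>f t\<bar>) (\<lambda>t. \<bar>g t\<bar>) \<Longrightarrow> N f \<le> N g"

definition directed_index :: "'i set \<Rightarrow> ('i \<Rightarrow> 'i \<Rightarrow> bool) \<Rightarrow> bool" where
  "directed_index I r \<longleftrightarrow> I \<noteq> {} \<and> (\<forall>i\<in>I. r i i) \<and>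
     (\<forall>i\<in>I. \<forall>j\<in>I. \<forall>k\<in>I. r i j \<longrightarrow> r j k \<longrightarrow> r i k) \<and>
     (\<forall>i\<in>I. \<forall>j\<in>I. \<exists>k\<in>I. r i k \<and> r j k)"

text \<open>\<open>x\<^sub>i \<down> z\<close> in the (pre)ordered set \<open>(E, le)\<close>; the infimum is taken in \<open>E\<close>.\<close>

definition net_decreases_to ::
  "'e set \<Rightarrow> ('e \<Rightarrow> 'e \<Rightarrow> bool) \<Rightarrow> 'i set \<Rightarrow> ('i \<Rightarrow> 'i \<Rightarrow> bool) \<Rightarrow> ('i \<Rightarrow> 'e) \<Rightarrow> 'e \<Rightarrow> bool" where
  "net_decreases_to E le I r x z \<longleftrightarrow> directed_index I r \<and>
     (\<forall>i\<in>I. x i \<in> E) \<and> (\<forall>i\<in>I. \<forall>j\<in>I. r i j \<longrightarrow> le (x j) (x i)) \<and>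
     z \<in> E \<and> (\<forall>i\<in>I. le z (x i)) \<and> (\<forall>y\<in>E. (\<forall>i\<in>I. le y (x i)) \<longrightarrow> le y z)"

definition net_norm_null ::
  "('e \<Rightarrow> real) \<Rightarrow> 'i set \<Rightarrow> ('i \<Rightarrow> 'i \<Rightarrow> bool) \<Rightarrow> ('i \<Rightarrow> 'e) \<Rightarrow> bool" where
  "net_norm_null nrm I r x \<longleftrightarrow> (\<forall>e>0. \<exists>i\<in>I. \<forall>j\<in>I. r i j \<longrightarrow> nrm (x j) < e)"

text \<open>
  A definition cannot quantify over index types, so the index sets here are taken
  inside the type of \<open>E\<close>; the lemma following the definition shows that nothing is lost.
\<close>

definition order_continuous_norm ::
  "'e set \<Rightarrow> ('e \<Rightarrow> 'e \<Rightarrow> bool) \<Rightarrow> 'e \<Rightarrow> ('e \<Rightarrow> real) \<Rightarrow> bool" where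
  "order_continuous_norm E le z nrm \<longleftrightarrow>
     (\<forall>(I :: 'e set) r x. net_decreases_to E le I r x z \<longrightarrow> net_norm_null nrm I r x)"

lemma order_continuous_norm_any_index:
  fixes I :: "'i set"
  assumes oc: "order_continuous_norm E le z nrm"
    and refl: "\<And>a. a \<in> E \<Longrightarrow> le a a"
    and trans: "\<And>a b c. a \<in> E \<Longrightarrow> b \<in> E \<Longrightarrow> c \<in> E \<Longrightarrow> le a b \<Longrightarrow> le b c \<Longrightarrow> le a c"
    and net: "net_decreases_to E le I r x z"
  shows "net_norm_null nrm I r x"
proof -
  have xE: "\<And>i. i \<in> I \<Longrightarrow> x i \<in> E"
    and dec: "\<And>i j. i \<in> I \<Longrightarrow> j \<in> I \<Longrightarrow> r i j \<Longrightarrow> le (x j) (x i)"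
    and dir: "\<And>i j. i \<in> I \<Longrightarrow> j \<in> I \<Longrightarrow> \<exists>k\<in>I. r i k \<and> r j k" and ne: "I \<noteq> {}"
    using net unfolding net_decreases_to_def directed_index_def by blast+
  have "directed_index (x ` I) (\<lambda>a b. le b a)"
    unfolding directed_index_def
  proof (intro conjI)
    show "\<forall>a\<in>x ` I. \<forall>b\<in>x ` I. \<exists>c\<in>x ` I. le c a \<and> le c b"
    proof (intro ballI)
      fix a b assume "a \<in> x ` I" "b \<in> x ` I"
      then obtain i j where ij: "i \<in> I" "a = x i" "j \<in> I" "b = x j" by blast
      then obtain k where "k \<in> I" "r i k" "r j k" using dir by blast
      then show "\<exists>c\<in>x ` I. le c a \<and> le c b" using dec ij by blast
    qed
    show "\<forall>a\<in>x ` I. \<forall>b\<in>x ` I. \<forall>c\<in>x ` I. le b a \<longrightarrow> le c b \<longrightarrow> le c a"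
    proof (intro ballI impI)
      fix a b c
      assume "a \<in> x ` I" "b \<in> x ` I" "c \<in> x ` I" and "le b a" "le c b"
      then show "le c a"
        using trans[of c b a] xE by blast
    qed
    show "\<forall>a\<in>x ` I. le a a"
      using refl xE by blast
    show "x ` I \<noteq> {}"
      using ne by simp
  qed
  then have "net_decreases_to E le (x ` I) (\<lambda>a b. le b a) (\<lambda>a. a) z"
    using net unfolding net_decreases_to_def by auto
  then have "net_norm_null nrm (x ` I) (\<lambda>a b. le b a) (\<lambda>a. a)"
    using oc unfolding order_continuous_norm_def by blast
  then have null: "\<forall>e>0. \<exists>a\<in>x ` I. \<forall>b\<in>x ` I. le b a \<longrightarrow> nrm b < e"
    unfolding net_norm_null_def .
  show ?thesis
    unfolding net_norm_null_def
  proof (intro allI impI)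
    fix e :: real assume "e > 0"
    then obtain i where "i \<in> I" "\<forall>b\<in>x ` I. le b (x i) \<longrightarrow> nrm b < e"
      using null by blast
    then show "\<exists>i\<in>I. \<forall>j\<in>I. r i j \<longrightarrow> nrm (x j) < e"
      using dec by blast
  qed
qed

definition order_converges ::
  "(real \<Rightarrow> real) set \<Rightarrow> (nat \<Rightarrow> real \<Rightarrow> real) \<Rightarrow> (real \<Rightarrow> real) \<Rightarrow> bool" where
  "order_converges X f l \<longleftrightarrow> l \<in> X \<and> (\<forall>n. f n \<in> X) \<and>
     (\<exists>g. net_decreases_to X ae_le (UNIV :: nat set) (\<le>) g (\<lambda>t. 0) \<and>
          (\<forall>n. ae_le (\<lambda>t. \<bar>f n t - l t\<bar>) (g n)))"

text \<open>Sequences are indexed from 0, so the term of index \<open>m\<close> averages the first \<open>m + 1\<close> functions.\<close>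

definition cesaro :: "(nat \<Rightarrow> real \<Rightarrow> real) \<Rightarrow> nat \<Rightarrow> real \<Rightarrow> real" where
  "cesaro f m = (\<lambda>t. (\<Sum>n\<le>m. f n t) / real (Suc m))"

definition norm_bounded_seq ::
  "(real \<Rightarrow> real) set \<Rightarrow> ((real \<Rightarrow> real) \<Rightarrow> real) \<Rightarrow> (nat \<Rightarrow> real \<Rightarrow> real) \<Rightarrow> bool" where
  "norm_bounded_seq X N f \<longleftrightarrow> (\<forall>n. f n \<in> X) \<and> (\<exists>C. \<forall>n. N (f n) \<le> C)"

definition has_order_cesaro_subseq ::
  "(real \<Rightarrow> real) set \<Rightarrow> (nat \<Rightarrow> real \<Rightarrow> real) \<Rightarrow> bool" where
  "has_order_cesaro_subseq X f \<longleftrightarrow>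
     (\<exists>s :: nat \<Rightarrow> nat. strict_mono s \<and> (\<exists>l\<in>X. order_converges X (cesaro (f \<circ> s)) l))"

definition associate_space :: "(real \<Rightarrow> real) set \<Rightarrow> (real \<Rightarrow> real) set" where
  "associate_space X =
     {g \<in> borel_measurable unit_leb. \<forall>f\<in>X. integrable unit_leb (\<lambda>t. f t * g t)}"

definition associate_null :: "(real \<Rightarrow> real) set \<Rightarrow> (nat \<Rightarrow> real \<Rightarrow> real) \<Rightarrow> bool" where
  "associate_null X f \<longleftrightarrow>
     (\<forall>g\<in>associate_space X. (\<lambda>n. \<integral>t. f n t * g t \<partial>unit_leb) \<longlonglongrightarrow> 0)"

definition oBSP :: "(real \<Rightarrow> real) set \<Rightarrow> ((real \<Rightarrow> real) \<Rightarrow> real) \<Rightarrow> bool" where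
  "oBSP X N \<longleftrightarrow> (\<forall>f. norm_bounded_seq X N f \<longrightarrow> has_order_cesaro_subseq X f)"

definition associate_oBSP :: "(real \<Rightarrow> real) set \<Rightarrow> ((real \<Rightarrow> real) \<Rightarrow> real) \<Rightarrow> bool" where
  "associate_oBSP X N \<longleftrightarrow>
     (\<forall>f. norm_bounded_seq X N f \<and> associate_null X f \<longrightarrow> has_order_cesaro_subseq X f)"

text \<open>
  The supremum is formed in the extended reals; that it belongs to \<open>X\<close> includes
  that it is finite a.e.
\<close>

definition monotonically_complete ::
  "(real \<Rightarrow> real) set \<Rightarrow> ((real \<Rightarrow> real) \<Rightarrow> real) \<Rightarrow> bool" where
  "monotonically_complete X N \<longleftrightarrow>
     (\<forall>f. norm_bounded_seq X N f \<and> (\<forall>n. ae_le (\<lambda>t. 0) (f n)) \<and> (\<forall>n. ae_le (f n) (f (Suc n)))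
        \<longrightarrow> (\<exists>g\<in>X. AE t in unit_leb. (SUP n. ereal (f n t)) = ereal (g t)))"

text \<open>
  Functionals on \<open>X\<close> are extensional, i.e. \<open>undefined\<close> off \<open>X\<close>, so that functionals
  that agree on \<open>X\<close> are equal.
\<close>

definition norm_dual ::
  "(real \<Rightarrow> real) set \<Rightarrow> ((real \<Rightarrow> real) \<Rightarrow> real) \<Rightarrow> ((real \<Rightarrow> real) \<Rightarrow> real) set" where
  "norm_dual X N = {\<phi> \<in> extensional X.
     (\<forall>f\<in>X. \<forall>g\<in>X. \<phi> (\<lambda>t. f t + g t) = \<phi> f + \<phi> g) \<and>
     (\<forall>c. \<forall>f\<in>X. \<phi> (\<lambda>t. c * f t) = c * \<phi> f) \<and>
     (\<exists>C. \<forall>f\<in>X. \<bar>\<phi> f\<bar> \<le> C * N f)}"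

definition dual_norm ::
  "(real \<Rightarrow> real) set \<Rightarrow> ((real \<Rightarrow> real) \<Rightarrow> real) \<Rightarrow> ((real \<Rightarrow> real) \<Rightarrow> real) \<Rightarrow> real" where
  "dual_norm X N \<phi> = (SUP f\<in>{f \<in> X. N f \<le> 1}. \<bar>\<phi> f\<bar>)"

definition dual_le ::
  "(real \<Rightarrow> real) set \<Rightarrow> ((real \<Rightarrow> real) \<Rightarrow> real) \<Rightarrow> ((real \<Rightarrow> real) \<Rightarrow> real) \<Rightarrow> bool" where
  "dual_le X \<phi> \<psi> \<longleftrightarrow> (\<forall>f\<in>X. ae_le (\<lambda>t. 0) f \<longrightarrow> \<phi> f \<le> \<psi> f)"

text \<open>
  The associate space as a Banach lattice of functionals: this identifies functions
  that induce the same functional, and order and norm are those of the dual.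
\<close>

definition associate_functionals ::
  "(real \<Rightarrow> real) set \<Rightarrow> ((real \<Rightarrow> real) \<Rightarrow> real) set" where
  "associate_functionals X =
     (\<lambda>g. (\<lambda>f\<in>X. \<integral>t. f t * g t \<partial>unit_leb)) ` associate_space X"

definition norm_dual_order_continuous ::
  "(real \<Rightarrow> real) set \<Rightarrow> ((real \<Rightarrow> real) \<Rightarrow> real) \<Rightarrow> bool" where
  "norm_dual_order_continuous X N \<longleftrightarrow>
     order_continuous_norm (norm_dual X N) (dual_le X) (\<lambda>f\<in>X. 0) (dual_norm X N)"

definition associate_order_continuous ::
  "(real \<Rightarrow> real) set \<Rightarrow> ((real \<Rightarrow> real) \<Rightarrow> real) \<Rightarrow> bool" where
  "associate_order_continuous X N \<longleftrightarrow>
     order_continuous_norm (associate_functionals X) (dual_le X) (\<lambda>f\<in>X. 0) (dual_norm X N)"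

end

theory Submission
  imports Defs "HOL-Library.Diagonal_Subsequence"
begin

text \<open>
  If \<open>X\<close> has oBSP and \<open>y\<close> is a bounded positive disjoint sequence in \<open>X\<close>, an order bound for the
  Cesaro means of a subsequence of \<open>y\<close> dominates \<open>\<Sum>n. y n / (n + 1)\<close> for that subsequence. Hence no
  positive functional stays away from \<open>0\<close> along \<open>y\<close>. A decreasing net of functionals that is
  pointwise null but not norm null would produce, by disjointification, exactly such a functional
  and such a sequence; so the dual is order continuous.

  Conversely, let \<open>X\<close> be monotonically complete with order continuous associate space. It suffices
  to find in every bounded sequence a subsequence that converges to an element of \<open>X\<close> when tested
  against the associate space. For a positive sequence \<open>f\<close>, take convex combinations of its tails
  that almost minimise the strictly convex functional \<open>y \<mapsto> \<integral> exp (- y)\<close>. They converge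
  a.e. along a subsequence, and the limit is in \<open>X\<close> by monotone completeness. If \<open>f\<close> is first
  replaced by a subsequence for which the asymptotic infimum of the functional is as large as
  possible, all further subsequences have the same limit \<open>y\<close>. Order continuity of the associate
  space turns a.e. convergence of bounded sequences into convergence of the integrals, so every
  limit point of \<open>\<integral> f n * g\<close> equals \<open>\<integral> y * g\<close>.
\<close>

section \<open>The unit interval, and Cesaro means of real sequences\<close>

lemma measure_unit_leb: "measure unit_leb (space unit_leb) = 1"
  by (simp add: measure_restrict_space)

interpretation unit_leb: finite_measure unit_leb
  by (rule finite_measure_lebesgue_on) simp

text \<open>All terms beyond index \<open>k\<close> are at least \<open>a k\<close>, and the earlier
  ones contribute only \<open>O(1/m)\<close> to the means, so the Cesaro limit bounds every
  \<open>a k\<close>. The sequence then converges to its supremum, which in turn bounds all the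
  means.\<close>

lemma incseq_tendsto_of_cesaro:
  fixes a :: "nat \<Rightarrow> real"
  assumes inc: "incseq a" and lim: "(\<lambda>m. (\<Sum>n\<le>m. a n) / real (Suc m)) \<longlonglongrightarrow> l"
  shows "a \<longlonglongrightarrow> l"
proof -
  have le: "a k \<le> l" for k
  proof -
    \<comment> \<open>For \<open>m \<ge> k\<close> this is the mean in which every term of index
      above \<open>k\<close> is replaced by \<open>a k\<close>, written as \<open>a k\<close> minus
      a vanishing correction.\<close>
    define b where "b m = a k - (\<Sum>n\<le>k. a k - a n) / real (Suc m)" for m
    have "b \<longlonglongrightarrow> a k - 0"
      unfolding b_def
      by (intro tendsto_diff tendsto_const real_tendsto_divide_at_top[OF tendsto_const]
          filterlim_compose[OF filterlim_real_sequentially filterlim_Suc])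
    moreover have "b m \<le> (\<Sum>n\<le>m. a n) / real (Suc m)" if "m \<ge> k" for m
    proof -
      have "(\<Sum>n\<le>m. a k - a n) \<le> (\<Sum>n\<le>k. a k - a n)"
      proof -
        have "(\<Sum>n\<in>{..m} - {..k}. a k - a n) \<le> 0"
          by (intro sum_nonpos) (use incseqD[OF inc] in auto)
        then show ?thesis
          using that sum.subset_diff[of "{..k}" "{..m}" "\<lambda>n. a k - a n"] by simp
      qed
      then have "real (Suc m) * a k - (\<Sum>n\<le>k. a k - a n) \<le> (\<Sum>n\<le>m. a n)"
        by (simp add: sum_subtractf)
      then have "(real (Suc m) * a k - (\<Sum>n\<le>k. a k - a n)) / real (Suc m)
          \<le> (\<Sum>n\<le>m. a n) / real (Suc m)"
        by (intro divide_right_mono) auto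
      then show ?thesis unfolding b_def by (simp add: diff_divide_distrib)
    qed
    ultimately show ?thesis
      using LIMSEQ_le[of b "a k" _ l] lim by auto
  qed
  have "a \<longlonglongrightarrow> (SUP n. a n)"
    using inc le by (intro LIMSEQ_incseq_SUP bdd_aboveI[of _ l]) auto
  moreover have "(SUP n. a n) \<le> l" using le by (intro cSUP_least) auto
  moreover have "l \<le> (SUP n. a n)"
  proof (rule LIMSEQ_le_const2[OF lim])
    have "(\<Sum>n\<le>m. a n) / real (Suc m) \<le> (SUP n. a n)" for m
    proof -
      have "(\<Sum>n\<le>m. a n) \<le> (\<Sum>n\<le>m. (SUP n. a n))"
        using le by (intro sum_mono cSUP_upper bdd_aboveI[of _ l]) auto
      then show ?thesis by (simp add: field_simps)
    qed
    then show "\<exists>N. \<forall>m\<ge>N. (\<Sum>n\<le>m. a n) / real (Suc m) \<le> (SUP n. a n)" by blast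
  qed
  ultimately show ?thesis by (metis order_antisym)
qed

context banach_function_space
begin

section \<open>Solidity and lattice operations in \<open>X\<close>\<close>

lemma meas [measurable_dest]: "f \<in> X \<Longrightarrow> f \<in> borel_measurable unit_leb"
  using measurable by blast

lemma solidI:
  assumes "f \<in> borel_measurable unit_leb" "g \<in> X" "AE t in unit_leb. \<bar>f t\<bar> \<le> \<bar>g t\<bar>"
  shows "f \<in> X" "N f \<le> N g"
  using solid[of f g] norm_mono[of f g] assms by (auto simp: ae_le_def)

lemma uminus_mem: "f \<in> X \<Longrightarrow> (\<lambda>t. - f t) \<in> X"
  using scale_mem[of f "-1"] by simp

lemma diff_mem: "f \<in> X \<Longrightarrow> g \<in> X \<Longrightarrow> (\<lambda>t. f t - g t) \<in> X"
  using add_mem[OF _ uminus_mem, of f g] by simp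

lemma divide_mem: "f \<in> X \<Longrightarrow> (\<lambda>t. f t / c) \<in> X"
  using scale_mem[of f "1 / c"] by simp

lemma abs_mem: "f \<in> X \<Longrightarrow> (\<lambda>t. \<bar>f t\<bar>) \<in> X"
  by (rule solidI(1)[of _ f]) auto

lemma norm_abs: "f \<in> X \<Longrightarrow> N (\<lambda>t. \<bar>f t\<bar>) = N f"
  using solidI(2)[of "\<lambda>t. \<bar>f t\<bar>" f] solidI(2)[of f "\<lambda>t. \<bar>f t\<bar>"] abs_mem[of f]
  by (auto intro!: antisym simp: meas)

lemma pos_part_mem: "f \<in> X \<Longrightarrow> (\<lambda>t. max 0 (f t)) \<in> X" "f \<in> X \<Longrightarrow> N (\<lambda>t. max 0 (f t)) \<le> N f"
proof -
  assume f: "f \<in> X"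
  show "(\<lambda>t. max 0 (f t)) \<in> X" "N (\<lambda>t. max 0 (f t)) \<le> N f"
    by (rule solidI[of _ f]; use f in \<open>auto simp: max_def\<close>)+
qed

lemma indicator_mem:
  assumes "f \<in> X" "A \<in> sets unit_leb"
  shows "(\<lambda>t. f t * indicator A t) \<in> X" "N (\<lambda>t. f t * indicator A t) \<le> N f"
  by (rule solidI[of _ f]; use assms in \<open>auto simp: indicator_def\<close>)+

lemma sum_mem: "(\<And>i. i \<in> I \<Longrightarrow> f i \<in> X) \<Longrightarrow> (\<lambda>t. \<Sum>i\<in>I. f i t) \<in> X"
  by (induction I rule: infinite_finite_induct) (auto simp: zero_mem intro: add_mem)

lemma norm_zero [simp]: "N (\<lambda>t. 0) = 0"
  using norm_eq_0[OF zero_mem] by simp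

lemma norm_sum_le: "(\<And>i. i \<in> I \<Longrightarrow> f i \<in> X) \<Longrightarrow> N (\<lambda>t. \<Sum>i\<in>I. f i t) \<le> (\<Sum>i\<in>I. N (f i))"
proof (induction I rule: infinite_finite_induct)
  case (insert i I)
  have "N (\<lambda>t. f i t + (\<Sum>j\<in>I. f j t)) \<le> N (f i) + N (\<lambda>t. \<Sum>j\<in>I. f j t)"
    using insert by (intro norm_triangle sum_mem) auto
  with insert show ?case by auto
qed auto

subsection \<open>Order convergence and Cesaro means\<close>

text \<open>The decreasing bounds have infimum \<open>0\<close> only in the order of
  \<open>X\<close>. Their pointwise infimum is dominated by \<open>g 0\<close>, hence lies in
  \<open>X\<close> by solidity and is itself a lower bound; so it is \<open>0\<close> a.e., and the
  bounds tend to \<open>0\<close> a.e.\<close>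

lemma order_converges_AE:
  assumes "order_converges X f l"
  shows "AE t in unit_leb. (\<lambda>n. f n t) \<longlonglongrightarrow> l t"
proof -
  obtain g where net: "net_decreases_to X ae_le (UNIV :: nat set) (\<le>) g (\<lambda>t. 0)"
    and le: "\<And>n. ae_le (\<lambda>t. \<bar>f n t - l t\<bar>) (g n)"
    using assms by (auto simp: order_converges_def)
  have g: "\<And>n. g n \<in> X" and dec: "\<And>m n. m \<le> n \<Longrightarrow> ae_le (g n) (g m)"
    and pos: "\<And>n. ae_le (\<lambda>t. 0) (g n)"
    and inf: "\<And>y. y \<in> X \<Longrightarrow> (\<And>n. ae_le y (g n)) \<Longrightarrow> ae_le y (\<lambda>t. 0)"
    using net by (auto simp: net_decreases_to_def)
  have [measurable]: "g n \<in> borel_measurable unit_leb" for n using g by (simp add: meas)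
  define i where "i t = (INF n. g n t)" for t
  have ae: "AE t in unit_leb. \<forall>n. 0 \<le> g n t \<and> g (Suc n) t \<le> g n t \<and> \<bar>f n t - l t\<bar> \<le> g n t"
    using pos le dec[OF le_SucI[OF order_refl]] by (auto simp: ae_le_def AE_all_countable)
  have i_lim: "(\<lambda>n. g n t) \<longlonglongrightarrow> i t \<and> 0 \<le> i t \<and> (\<forall>n. i t \<le> g n t)"
    if "\<forall>n. 0 \<le> g n t \<and> g (Suc n) t \<le> g n t" for t
  proof -
    have bdd: "bdd_below (range (\<lambda>n. g n t))"
      using that by (intro bdd_belowI[of _ 0]) auto
    have "decseq (\<lambda>n. g n t)" using that by (intro decseq_SucI) auto
    with bdd have "(\<lambda>n. g n t) \<longlonglongrightarrow> i t" unfolding i_def by (rule LIMSEQ_decseq_INF)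
    moreover have "0 \<le> i t" unfolding i_def using that by (intro cINF_greatest) auto
    moreover have "i t \<le> g n t" for n unfolding i_def using bdd by (intro cINF_lower) auto
    ultimately show ?thesis by blast
  qed
  have iX: "i \<in> X"
  proof (rule solidI(1)[OF _ g[of 0]])
    show "i \<in> borel_measurable unit_leb" unfolding i_def[abs_def] by measurable
    show "AE t in unit_leb. \<bar>i t\<bar> \<le> \<bar>g 0 t\<bar>"
      using ae by eventually_elim (use i_lim in fastforce)
  qed
  have "ae_le i (\<lambda>t. 0)"
  proof (rule inf[OF iX])
    show "ae_le i (g n)" for n
      unfolding ae_le_def using ae by eventually_elim (use i_lim in fastforce)
  qed
  then have "AE t in unit_leb. i t \<le> 0" by (simp add: ae_le_def)
  with ae show ?thesis
  proof eventually_elim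
    case (elim t)
    with i_lim[of t] have "(\<lambda>n. g n t) \<longlonglongrightarrow> 0" by (metis order_antisym)
    then have "(\<lambda>n. f n t - l t) \<longlonglongrightarrow> 0"
      by (rule Lim_null_comparison[rotated]) (use elim in auto)
    then show ?case by (simp add: LIM_zero_iff)
  qed
qed

lemma order_converges_bounded:
  assumes "order_converges X f l"
  obtains h where "h \<in> X" "\<And>n. AE t in unit_leb. \<bar>f n t\<bar> \<le> h t"
proof -
  obtain g where net: "net_decreases_to X ae_le (UNIV :: nat set) (\<le>) g (\<lambda>t. 0)"
    and le: "\<And>n. ae_le (\<lambda>t. \<bar>f n t - l t\<bar>) (g n)" and l: "l \<in> X"
    using assms by (auto simp: order_converges_def)
  have g: "\<And>n. g n \<in> X" and dec: "\<And>n. ae_le (g n) (g 0)"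
    using net by (auto simp: net_decreases_to_def)
  show thesis
  proof (rule that)
    show "(\<lambda>t. g 0 t + \<bar>l t\<bar>) \<in> X" using g l by (intro add_mem abs_mem)
    show "AE t in unit_leb. \<bar>f n t\<bar> \<le> g 0 t + \<bar>l t\<bar>" for n
      using le[of n] dec[of n] by (auto simp: ae_le_def elim!: eventually_elim2)
  qed
qed

text \<open>At almost every point the values increase and some subsequence has means converging to
  \<open>l t\<close>. By \<open>incseq_tendsto_of_cesaro\<close> that subsequence, and with it the
  whole sequence, increases to \<open>l t\<close>; so the supremum is the order limit
  \<open>l\<close>.\<close>

lemma oBSP_imp_monotonically_complete:
  assumes "oBSP X N"
  shows "monotonically_complete X N"
  unfolding monotonically_complete_def
proof (intro allI impI, elim conjE)
  fix f assume f: "norm_bounded_seq X N f" and pos: "\<forall>n. ae_le (\<lambda>t. 0) (f n)"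
    and inc: "\<forall>n. ae_le (f n) (f (Suc n))"
  obtain s l where s: "strict_mono (s :: nat \<Rightarrow> nat)" and "l \<in> X"
    and conv: "order_converges X (cesaro (f \<circ> s)) l"
    using assms f unfolding oBSP_def has_order_cesaro_subseq_def by blast
  have "AE t in unit_leb. \<forall>n. f n t \<le> f (Suc n) t"
    using inc by (simp add: ae_le_def AE_all_countable)
  moreover have "AE t in unit_leb. (\<lambda>n. cesaro (f \<circ> s) n t) \<longlonglongrightarrow> l t"
    using conv by (rule order_converges_AE)
  ultimately have "AE t in unit_leb. (SUP n. ereal (f n t)) = ereal (l t)"
  proof eventually_elim
    case (elim t)
    then have inc: "incseq (\<lambda>n. f n t)" by (intro incseq_SucI) auto
    then have "incseq (\<lambda>n. f (s n) t)"
      using s by (auto simp: incseq_def strict_mono_less_eq)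
    moreover have "(\<lambda>m. (\<Sum>n\<le>m. f (s n) t) / real (Suc m)) \<longlonglongrightarrow> l t"
      using elim by (simp add: cesaro_def)
    ultimately have lim: "(\<lambda>n. f (s n) t) \<longlonglongrightarrow> l t" by (rule incseq_tendsto_of_cesaro)
    have "incseq (\<lambda>n. ereal (f n t))" using inc by (simp add: incseq_def)
    then have "(\<lambda>n. ereal (f n t)) \<longlonglongrightarrow> (SUP n. ereal (f n t))" by (rule LIMSEQ_SUP)
    then have "((\<lambda>n. ereal (f n t)) \<circ> s) \<longlonglongrightarrow> (SUP n. ereal (f n t))"
      using s by (rule LIMSEQ_subseq_LIMSEQ)
    moreover have "((\<lambda>n. ereal (f n t)) \<circ> s) \<longlonglongrightarrow> ereal (l t)"
      using lim by (simp add: comp_def)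
    ultimately show ?case by (rule LIMSEQ_unique)
  qed
  with \<open>l \<in> X\<close> show "\<exists>g\<in>X. AE t in unit_leb. (SUP n. ereal (f n t)) = ereal (g t)" by blast
qed


subsection \<open>Monotone completeness\<close>

lemma monotonically_completeD:
  assumes "monotonically_complete X N" "\<And>n. f n \<in> X" "\<And>n. N (f n) \<le> C"
    and "\<And>n. AE t in unit_leb. 0 \<le> f n t" "\<And>n. AE t in unit_leb. f n t \<le> f (Suc n) t"
  obtains h where "h \<in> X" "AE t in unit_leb. \<forall>n. f n t \<le> h t"
proof -
  obtain h where h: "h \<in> X" "AE t in unit_leb. (SUP n. ereal (f n t)) = ereal (h t)"
    using assms unfolding monotonically_complete_def norm_bounded_seq_def ae_le_def by blast
  have "AE t in unit_leb. \<forall>n. f n t \<le> h t"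
    using h(2)
  proof eventually_elim
    case (elim t)
    have "ereal (f n t) \<le> (SUP n. ereal (f n t))" for n by (rule SUP_upper) simp
    with elim show ?case by simp
  qed
  with h(1) show thesis by (rule that)
qed

text \<open>The weighted sums \<open>p n\<close> increase and have norm at most
  \<open>2 * C\<close>, so monotone completeness bounds them. This yields one element of
  \<open>X\<close> controlling the entire sequence, at the price of the factor
  \<open>2 ^ n\<close>.\<close>

lemma dominating_element:
  fixes f :: "nat \<Rightarrow> real \<Rightarrow> real"
  assumes mc: "monotonically_complete X N" and f: "\<And>n. f n \<in> X" and C: "\<And>n. N (f n) \<le> C"
  obtains h where "h \<in> X" "AE t in unit_leb. \<forall>n. \<bar>f n t\<bar> \<le> 2 ^ n * h t"
proof -
  define p where "p n = (\<lambda>t. \<Sum>i\<le>n. (1/2) ^ i * \<bar>f i t\<bar>)" for n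
  have summand: "(\<lambda>t. (1/2) ^ i * \<bar>f i t\<bar>) \<in> X" for i by (intro scale_mem abs_mem f)
  have C0: "0 \<le> C" using norm_nonneg[OF f[of 0]] C[of 0] by linarith
  have geo: "(\<Sum>i\<le>n. (1/2) ^ i) \<le> (2::real)" for n
    using sum_le_suminf[of "\<lambda>i. (1/2::real) ^ i" "{..n}"] suminf_geometric[of "1/2::real"]
    by (simp add: summable_geometric)
  obtain h where h: "h \<in> X" "AE t in unit_leb. \<forall>n. p n t \<le> h t"
  proof (rule monotonically_completeD[OF mc])
    show "p n \<in> X" for n unfolding p_def by (intro sum_mem summand)
    show "N (p n) \<le> 2 * C" for n
    proof -
      have "N (p n) \<le> (\<Sum>i\<le>n. N (\<lambda>t. (1/2) ^ i * \<bar>f i t\<bar>))"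
        unfolding p_def by (intro norm_sum_le summand)
      also have "\<dots> \<le> (\<Sum>i\<le>n. (1/2) ^ i * C)"
        by (intro sum_mono) (simp add: norm_scale abs_mem f norm_abs C)
      also have "\<dots> = (\<Sum>i\<le>n. (1/2) ^ i) * C" by (simp add: sum_distrib_right)
      also have "\<dots> \<le> 2 * C" using C0 geo by (intro mult_right_mono) auto
      finally show ?thesis .
    qed
    show "AE t in unit_leb. 0 \<le> p n t" for n by (simp add: p_def sum_nonneg)
    show "AE t in unit_leb. p n t \<le> p (Suc n) t" for n by (simp add: p_def)
  qed
  have "AE t in unit_leb. \<forall>n. \<bar>f n t\<bar> \<le> 2 ^ n * h t"
    using h(2)
  proof (eventually_elim, intro allI)
    fix t n assume "\<forall>n. p n t \<le> h t"
    moreover have "(1/2) ^ n * \<bar>f n t\<bar> \<le> p n t"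
      unfolding p_def by (rule member_le_sum) auto
    ultimately have "(1/2) ^ n * \<bar>f n t\<bar> \<le> h t" by (meson order_trans)
    then show "\<bar>f n t\<bar> \<le> 2 ^ n * h t" by (simp add: field_simps)
  qed
  with h(1) show thesis by (rule that)
qed

text \<open>A Fatou property: the tail infima \<open>p k\<close> increase and inherit the norm bound
  from \<open>f k\<close>. The conclusion bounds the lower limit of \<open>f\<close> by
  \<open>h\<close>; it is phrased through real lower bounds of the tails because the lower limit is
  not known beforehand to be finite.\<close>

lemma liminf_dominated:
  fixes f :: "nat \<Rightarrow> real \<Rightarrow> real"
  assumes mc: "monotonically_complete X N" and f: "\<And>n. f n \<in> X" and C: "\<And>n. N (f n) \<le> C"
    and pos: "\<And>n. AE t in unit_leb. 0 \<le> f n t"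
  obtains h where "h \<in> X" "AE t in unit_leb. \<forall>c k. (\<forall>j\<ge>k. c \<le> f j t) \<longrightarrow> c \<le> h t"
proof -
  define p where "p k = (\<lambda>t. INF j\<in>{k..}. f j t)" for k
  have [measurable]: "f n \<in> borel_measurable unit_leb" for n using f by (simp add: meas)
  have ae: "AE t in unit_leb. \<forall>n. 0 \<le> f n t" using pos by (simp add: AE_all_countable)
  have bdd: "bdd_below ((\<lambda>j. f j t) ` {k..})" if "\<forall>n. 0 \<le> f n t" for k t
    using that by (intro bdd_belowI[of _ 0]) auto
  have p_pos: "0 \<le> p k t" if "\<forall>n. 0 \<le> f n t" for k t
    unfolding p_def using that by (intro cINF_greatest) auto
  have p_le: "p k t \<le> f k t" if "\<forall>n. 0 \<le> f n t" for k t
    unfolding p_def using bdd[OF that] by (intro cINF_lower) auto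
  have p_inc: "p k t \<le> p (Suc k) t" if "\<forall>n. 0 \<le> f n t" for k t
    unfolding p_def using bdd[OF that] by (intro cINF_superset_mono) auto
  have p_bd: "AE t in unit_leb. \<bar>p k t\<bar> \<le> \<bar>f k t\<bar>" for k
    using ae
  proof eventually_elim
    case (elim t)
    then show ?case using p_pos[OF elim, of k] p_le[OF elim, of k] by simp
  qed
  have p_meas: "p k \<in> borel_measurable unit_leb" for k unfolding p_def by measurable
  obtain h where h: "h \<in> X" "AE t in unit_leb. \<forall>n. p n t \<le> h t"
  proof (rule monotonically_completeD[OF mc])
    show "p n \<in> X" for n by (rule solidI(1)[OF p_meas f p_bd])
    show "N (p n) \<le> C" for n using solidI(2)[OF p_meas f p_bd] C by (rule order_trans)
    show "AE t in unit_leb. 0 \<le> p n t" for n using ae by eventually_elim (rule p_pos)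
    show "AE t in unit_leb. p n t \<le> p (Suc n) t" for n using ae by eventually_elim (rule p_inc)
  qed
  have "AE t in unit_leb. \<forall>c k. (\<forall>j\<ge>k. c \<le> f j t) \<longrightarrow> c \<le> h t"
    using h(2)
  proof (eventually_elim, intro allI impI)
    fix t c k assume *: "\<forall>n. p n t \<le> h t" "\<forall>j\<ge>k. c \<le> f j t"
    have "c \<le> p k t" unfolding p_def using *(2) by (intro cINF_greatest) auto
    with *(1) show "c \<le> h t" by (meson order_trans)
  qed
  with h(1) show thesis by (rule that)
qed

text \<open>The limit coincides with the lower limit, so the element from
  \<open>liminf_dominated\<close> dominates it and solidity applies.\<close>

lemma AE_limit_mem:
  fixes f :: "nat \<Rightarrow> real \<Rightarrow> real"
  assumes mc: "monotonically_complete X N" and f: "\<And>n. f n \<in> X" and C: "\<And>n. N (f n) \<le> C"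
    and pos: "\<And>n. AE t in unit_leb. 0 \<le> f n t"
    and z: "z \<in> borel_measurable unit_leb" and lim: "AE t in unit_leb. (\<lambda>n. f n t) \<longlonglongrightarrow> z t"
  shows "z \<in> X"
proof -
  obtain h where h: "h \<in> X" "AE t in unit_leb. \<forall>c k. (\<forall>j\<ge>k. c \<le> f j t) \<longrightarrow> c \<le> h t"
    by (rule liminf_dominated[OF mc f C pos])
  have ae: "AE t in unit_leb. \<forall>n. 0 \<le> f n t" using pos by (simp add: AE_all_countable)
  show ?thesis
  proof (rule solidI(1)[OF z h(1)])
    show "AE t in unit_leb. \<bar>z t\<bar> \<le> \<bar>h t\<bar>"
      using h(2) lim ae
    proof eventually_elim
      case (elim t)
      then have "0 \<le> z t" by (intro LIMSEQ_le_const[of "\<lambda>n. f n t"]) auto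
      moreover have "z t \<le> h t"
      proof (rule dense_ge)
        fix h' assume "h t < h'"
        show "z t \<le> h'"
        proof (rule ccontr)
          assume "\<not> z t \<le> h'"
          then have "eventually (\<lambda>n. h' < f n t) sequentially"
            using elim(2) by (intro order_tendstoD) auto
          then obtain k where "\<forall>j\<ge>k. h' \<le> f j t"
            by (auto simp: eventually_sequentially intro: less_imp_le)
          with elim(1) have "h' \<le> h t" by blast
          with \<open>h t < h'\<close> show False by simp
        qed
      qed
      ultimately show ?case by simp
    qed
  qed
qed

subsection \<open>The associate space\<close>

lemma assoc_meas [measurable_dest]: "g \<in> associate_space X \<Longrightarrow> g \<in> borel_measurable unit_leb"
  by (simp add: associate_space_def)

lemma assoc_integrable:
  "g \<in> associate_space X \<Longrightarrow> f \<in> X \<Longrightarrow> integrable unit_leb (\<lambda>t. f t * g t)"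
  by (simp add: associate_space_def)

lemma assoc_solid:
  assumes g: "g \<in> associate_space X" and h: "h \<in> borel_measurable unit_leb"
    and le: "AE t in unit_leb. \<bar>h t\<bar> \<le> \<bar>g t\<bar>"
  shows "h \<in> associate_space X"
  unfolding associate_space_def
proof (safe intro!: h)
  fix f assume f: "f \<in> X"
  show "integrable unit_leb (\<lambda>t. f t * h t)"
  proof (rule Bochner_Integration.integrable_bound[OF assoc_integrable[OF g f]])
    show "(\<lambda>t. f t * h t) \<in> borel_measurable unit_leb" using h f by (auto dest: meas)
    show "AE t in unit_leb. norm (f t * h t) \<le> norm (f t * g t)"
      using le by eventually_elim (simp add: abs_mult mult_left_mono)
  qed
qed

text \<open>Without a bound there would be normalised \<open>F n\<close> for which the integral of
  \<open>|F n * g|\<close> exceeds \<open>4 ^ n\<close>. A single \<open>h\<close> in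
  \<open>X\<close> satisfies \<open>|F n| \<le> 2 ^ n * h\<close>, so the integral of
  \<open>|h * g|\<close> would exceed every \<open>2 ^ n\<close>.\<close>

lemma assoc_bounded:
  assumes mc: "monotonically_complete X N" and g: "g \<in> associate_space X"
  shows "\<exists>C. \<forall>f\<in>X. (\<integral>t. \<bar>f t * g t\<bar> \<partial>unit_leb) \<le> C * N f"
proof (rule ccontr)
  assume no: "\<not> ?thesis"
  have "\<forall>n::nat. \<exists>f. f \<in> X \<and> 4 ^ n * N f < (\<integral>t. \<bar>f t * g t\<bar> \<partial>unit_leb)"
    using no by (auto simp: not_le)
  from choice[OF this] obtain f where f: "\<And>n::nat. f n \<in> X"
    and big: "\<And>n. 4 ^ n * N (f n) < (\<integral>t. \<bar>f n t * g t\<bar> \<partial>unit_leb)" by blast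
  have pos: "0 < N (f n)" for n
  proof (rule ccontr)
    assume "\<not> 0 < N (f n)"
    with norm_nonneg[OF f] have 0: "N (f n) = 0" by (metis less_le)
    then have "AE t in unit_leb. f n t = 0" using norm_eq_0[OF f] by blast
    then have "(\<integral>t. \<bar>f n t * g t\<bar> \<partial>unit_leb) = 0"
      by (intro integral_eq_zero_AE) auto
    with big[of n] 0 show False by simp
  qed
  define F where "F n = (\<lambda>t. (1 / N (f n)) * f n t)" for n
  have F: "F n \<in> X" for n unfolding F_def by (intro scale_mem f)
  have NF: "N (F n) \<le> 1" for n
    using norm_scale[OF f, of "1 / N (f n)" n] pos[of n] by (simp add: F_def)
  obtain h where h: "h \<in> X" "AE t in unit_leb. \<forall>n. \<bar>F n t\<bar> \<le> 2 ^ n * h t"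
    by (rule dominating_element[OF mc F NF])
  have hg: "integrable unit_leb (\<lambda>t. \<bar>h t * g t\<bar>)"
    using assoc_integrable[OF g h(1)] by simp
  have "2 ^ n < (\<integral>t. \<bar>h t * g t\<bar> \<partial>unit_leb)" for n :: nat
  proof -
    have "4 ^ n * N (f n) / N (f n) < (\<integral>t. \<bar>f n t * g t\<bar> \<partial>unit_leb) / N (f n)"
      using big pos by (intro divide_strict_right_mono)
    also have "\<dots> = (\<integral>t. \<bar>F n t * g t\<bar> \<partial>unit_leb)"
      using pos[of n] by (simp add: F_def abs_mult)
    also have "\<dots> \<le> (\<integral>t. 2 ^ n * \<bar>h t * g t\<bar> \<partial>unit_leb)"
    proof (rule integral_mono_AE)
      show "integrable unit_leb (\<lambda>t. \<bar>F n t * g t\<bar>)" using assoc_integrable[OF g F] by simp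
      show "AE t in unit_leb. \<bar>F n t * g t\<bar> \<le> 2 ^ n * \<bar>h t * g t\<bar>"
        using h(2)
      proof eventually_elim
        case (elim t)
        then have "\<bar>F n t\<bar> \<le> 2 ^ n * \<bar>h t\<bar>"
          by (smt (verit) mult_left_mono zero_le_power)
        then show ?case using mult_right_mono[of "\<bar>F n t\<bar>" "2 ^ n * \<bar>h t\<bar>" "\<bar>g t\<bar>"]
          by (simp add: abs_mult mult.assoc)
      qed
    qed (use hg in simp)
    also have "\<dots> = 2 ^ n * (\<integral>t. \<bar>h t * g t\<bar> \<partial>unit_leb)" by simp
    finally have "2 ^ n * 2 ^ n < 2 ^ n * (\<integral>t. \<bar>h t * g t\<bar> \<partial>unit_leb)"
      using pos[of n] by (simp flip: power_mult_distrib)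
    then show ?thesis by simp
  qed
  moreover obtain n where "(\<integral>t. \<bar>h t * g t\<bar> \<partial>unit_leb) < 2 ^ n"
    using real_arch_pow[of 2] by auto
  ultimately show False by (meson less_asym)
qed

definition functional :: "(real \<Rightarrow> real) \<Rightarrow> (real \<Rightarrow> real) \<Rightarrow> real" where
  "functional g = (\<lambda>f\<in>X. \<integral>t. f t * g t \<partial>unit_leb)"

lemma functional_apply: "f \<in> X \<Longrightarrow> functional g f = (\<integral>t. f t * g t \<partial>unit_leb)"
  by (simp add: functional_def)

lemma functional_zero: "functional (\<lambda>t. 0) = (\<lambda>f\<in>X. 0)"
  by (simp add: functional_def)

lemma associate_functionals_eq: "associate_functionals X = functional ` associate_space X"
  by (simp add: associate_functionals_def functional_def)

lemma functional_norm_dual: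
  assumes mc: "monotonically_complete X N" and g: "g \<in> associate_space X"
  shows "functional g \<in> norm_dual X N"
proof -
  obtain C where C: "\<forall>f\<in>X. (\<integral>t. \<bar>f t * g t\<bar> \<partial>unit_leb) \<le> C * N f"
    using assoc_bounded[OF mc g] by blast
  have "\<bar>functional g f\<bar> \<le> C * N f" if "f \<in> X" for f
    using order_trans[OF integral_abs_bound bspec[OF C that]] by (simp add: functional_apply that)
  then show ?thesis
    unfolding norm_dual_def
    by (auto simp: functional_apply add_mem scale_mem distrib_right assoc_integrable[OF g] mult.assoc)
       (auto simp: functional_def)
qed

lemma dual_bound:
  assumes \<phi>: "\<phi> \<in> norm_dual X N"
  shows "bdd_above ((\<lambda>f. \<bar>\<phi> f\<bar>) ` {f \<in> X. N f \<le> 1})"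
proof -
  obtain C where C: "\<forall>f\<in>X. \<bar>\<phi> f\<bar> \<le> C * N f"
    using \<phi> by (auto simp: norm_dual_def)
  show ?thesis
  proof (rule bdd_aboveI[of _ "\<bar>C\<bar>"], safe)
    fix f assume f: "f \<in> X" "N f \<le> 1"
    have "C * N f \<le> \<bar>C\<bar> * 1"
      using f norm_nonneg[OF f(1)] by (intro mult_mono) auto
    with bspec[OF C f(1)] show "\<bar>\<phi> f\<bar> \<le> \<bar>C\<bar>" by simp
  qed
qed

lemma dual_zero_mem: "\<phi> \<in> norm_dual X N \<Longrightarrow> \<phi> (\<lambda>t. 0) = 0"
proof -
  assume "\<phi> \<in> norm_dual X N"
  then have "\<forall>c. \<forall>f\<in>X. \<phi> (\<lambda>t. c * f t) = c * \<phi> f" by (simp add: norm_dual_def)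
  from bspec[OF spec[OF this, of 0] zero_mem] show ?thesis by simp
qed

lemma abs_le_dual_norm:
  assumes \<phi>: "\<phi> \<in> norm_dual X N" and f: "f \<in> X"
  shows "\<bar>\<phi> f\<bar> \<le> dual_norm X N \<phi> * N f"
proof (cases "N f = 0")
  case True
  \<comment> \<open>Scaling to the unit ball is impossible here, but the bound
    \<open>C * N f\<close> forces \<open>\<phi> f = 0\<close>.\<close>
  then show ?thesis using \<phi> f unfolding norm_dual_def by force
next
  case False
  then have pos: "0 < N f" using norm_nonneg[OF f] by linarith
  have mem: "(\<lambda>t. (1 / N f) * f t) \<in> {f \<in> X. N f \<le> 1}"
    using f pos norm_scale[OF f, of "1 / N f"] scale_mem[OF f, of "1 / N f"] by simp
  have "\<bar>\<phi> (\<lambda>t. (1 / N f) * f t)\<bar> \<le> dual_norm X N \<phi>"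
    unfolding dual_norm_def by (rule cSUP_upper[OF mem dual_bound[OF \<phi>]])
  moreover have "\<phi> (\<lambda>t. (1 / N f) * f t) = (1 / N f) * \<phi> f"
    using \<phi> f unfolding norm_dual_def by blast
  ultimately have "(1 / N f) * \<bar>\<phi> f\<bar> \<le> dual_norm X N \<phi>"
    using pos by (simp add: abs_mult)
  then show ?thesis using pos by (simp add: field_simps)
qed

text \<open>Testing the functionals on \<open>f\<close> restricted to the set \<open>B\<close> of
  failure shows that \<open>B\<close> is null. The premise \<open>0 < f t\<close> reflects that
  \<open>X\<close> may lack full support: densities can be compared only where some element of
  \<open>X\<close> is nonzero.\<close>

lemma functional_le_AE:
  assumes g: "g \<in> associate_space X" "g' \<in> associate_space X" and f: "f \<in> X"
    and le: "dual_le X (functional g) (functional g')"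
  shows "AE t in unit_leb. 0 < f t \<longrightarrow> g t \<le> g' t"
proof -
  define B where "B = {t \<in> space unit_leb. 0 < f t \<and> g' t < g t}"
  have [measurable]: "f \<in> borel_measurable unit_leb" "g \<in> borel_measurable unit_leb"
    "g' \<in> borel_measurable unit_leb"
    using g f by (auto intro: meas assoc_meas)
  have B [measurable]: "B \<in> sets unit_leb" unfolding B_def by measurable
  define p where "p t = f t * indicator B t" for t
  have p: "p \<in> X" unfolding p_def[abs_def] by (rule indicator_mem(1)[OF f B])
  have "functional g p \<le> functional g' p"
    using le p unfolding dual_le_def ae_le_def
    by (auto simp: p_def B_def indicator_def)
  then have le0: "(\<integral>t. p t * (g t - g' t) \<partial>unit_leb) \<le> 0"
    using assoc_integrable[OF g(1) p] assoc_integrable[OF g(2) p]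
    by (simp add: functional_apply p right_diff_distrib)
  have int: "integrable unit_leb (\<lambda>t. p t * (g t - g' t))"
    using assoc_integrable[OF g(1) p] assoc_integrable[OF g(2) p]
    by (simp add: right_diff_distrib)
  have nn: "AE t in unit_leb. 0 \<le> p t * (g t - g' t)"
    by (auto simp: p_def B_def indicator_def)
  have "(\<integral>t. p t * (g t - g' t) \<partial>unit_leb) = 0"
    using le0 integral_nonneg_AE[OF nn] by linarith
  then have "AE t in unit_leb. p t * (g t - g' t) = 0"
    using integral_nonneg_eq_0_iff_AE[OF int nn] by blast
  moreover have "AE t in unit_leb. t \<in> space unit_leb" by (rule AE_space)
  ultimately show ?thesis
    by eventually_elim (auto simp: p_def B_def indicator_def split: if_splits)
qed

lemma functional_mono_AE:
  assumes g: "g \<in> associate_space X" "g' \<in> associate_space X" and f: "f \<in> X"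
    and pos: "AE t in unit_leb. 0 \<le> f t" and le: "AE t in unit_leb. 0 < f t \<longrightarrow> g t \<le> g' t"
  shows "functional g f \<le> functional g' f"
  unfolding functional_apply[OF f]
proof (rule integral_mono_AE[OF assoc_integrable[OF g(1) f] assoc_integrable[OF g(2) f]])
  show "AE t in unit_leb. f t * g t \<le> f t * g' t"
    using pos le by eventually_elim (auto simp: order_le_less)
qed


section \<open>Order continuity of the associate space and weak limits of a.e. convergent
  sequences\<close>

text \<open>The functionals with density \<open>|g|\<close> restricted to \<open>A n\<close>
  decrease and, by dominated convergence, tend to \<open>0\<close> at every \<open>f\<close>. They
  therefore decrease to \<open>0\<close> in the associate lattice, and their dual norms become
  small; evaluating at \<open>|f|\<close> gives an estimate uniform over the unit ball.\<close>

lemma assoc_absolutely_continuous: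
  fixes A :: "nat \<Rightarrow> real set"
  assumes mc: "monotonically_complete X N" and oc: "associate_order_continuous X N"
    and g: "g \<in> associate_space X" and A: "\<And>n. A n \<in> sets unit_leb"
    and dec: "\<And>n. A (Suc n) \<subseteq> A n" and null: "AE t in unit_leb. \<exists>n. t \<notin> A n"
    and e: "e > 0"
  shows "\<exists>n. \<forall>f\<in>X. (\<integral>t. \<bar>f t * g t\<bar> * indicator (A n) t \<partial>unit_leb) \<le> e * N f"
proof -
  define G where "G n = (\<lambda>t. \<bar>g t\<bar> * indicator (A n) t)" for n
  have [measurable]: "g \<in> borel_measurable unit_leb" "\<And>n. A n \<in> sets unit_leb"
    using g A by (auto intro: assoc_meas)
  have G: "G n \<in> associate_space X" for n
  proof (rule assoc_solid[OF g])
    show "G n \<in> borel_measurable unit_leb" unfolding G_def by measurable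
  qed (auto simp: G_def indicator_def)
  have dec': "m \<le> n \<Longrightarrow> A n \<subseteq> A m" for m n using lift_Suc_antimono_le[of A] dec by blast
  have G_dec: "G n t \<le> G m t" if "m \<le> n" for m n t
    using dec'[OF that] by (auto simp: G_def indicator_def)
  have lim: "(\<lambda>n. functional (G n) f) \<longlonglongrightarrow> 0" if f: "f \<in> X" for f
  proof -
    have "(\<lambda>n. \<integral>t. f t * G n t \<partial>unit_leb) \<longlonglongrightarrow> (\<integral>t. 0 \<partial>unit_leb)"
    proof (rule integral_dominated_convergence)
      show "integrable unit_leb (\<lambda>t. \<bar>f t * g t\<bar>)" using assoc_integrable[OF g f] by simp
      show "(\<lambda>t. f t * G n t) \<in> borel_measurable unit_leb" for n
        using assoc_integrable[OF G f] by blast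
      show "AE t in unit_leb. norm (f t * G n t) \<le> \<bar>f t * g t\<bar>" for n
        by (simp add: G_def abs_mult indicator_def)
      show "AE t in unit_leb. (\<lambda>n. f t * G n t) \<longlonglongrightarrow> 0"
        using null
      proof eventually_elim
        case (elim t)
        then obtain m where m: "t \<notin> A m" by blast
        have "\<forall>n\<ge>m. f t * G n t = 0" using dec' m by (auto simp: G_def indicator_def)
        then show ?case by (intro tendsto_eventually) (auto simp: eventually_sequentially)
      qed
    qed simp
    then show ?thesis by (simp add: functional_apply f)
  qed
  have net: "net_decreases_to (associate_functionals X) (dual_le X) (UNIV :: nat set) (\<le>)
      (\<lambda>n. functional (G n)) (\<lambda>f\<in>X. 0)"
    unfolding net_decreases_to_def
  proof (intro conjI ballI impI)
    show "directed_index (UNIV :: nat set) (\<le>)"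
      unfolding directed_index_def by (auto intro: max.cobounded1 max.cobounded2)
    show "functional (G n) \<in> associate_functionals X" for n
      using G by (auto simp: associate_functionals_eq)
    have "(\<lambda>t. 0) \<in> associate_space X" by (simp add: associate_space_def)
    then show "(\<lambda>f\<in>X. 0) \<in> associate_functionals X"
      unfolding associate_functionals_eq functional_zero[symmetric] by blast
    show "dual_le X (functional (G n)) (functional (G m))" if "m \<le> n" for m n
      unfolding dual_le_def ae_le_def
      by (intro ballI impI functional_mono_AE G) (auto simp: G_dec that)
    show "dual_le X (\<lambda>f\<in>X. 0) (functional (G n))" for n
      unfolding dual_le_def ae_le_def
    proof (intro ballI impI)
      fix f assume f: "f \<in> X" "AE t in unit_leb. 0 \<le> f t"
      have "0 \<le> (\<integral>t. f t * G n t \<partial>unit_leb)"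
        by (rule integral_nonneg_AE) (use f(2) in \<open>auto simp: G_def\<close>)
      then show "(\<lambda>f\<in>X. 0) f \<le> functional (G n) f" using f by (simp add: functional_apply)
    qed
    \<comment> \<open>A lower bound stays below every term at nonnegative \<open>f\<close>, hence
      below their limit \<open>0\<close>.\<close>
    fix y assume y: "\<forall>n\<in>UNIV. dual_le X y (functional (G n))"
    show "dual_le X y (\<lambda>f\<in>X. 0)"
      unfolding dual_le_def
    proof (intro ballI impI)
      fix f assume f: "f \<in> X" "ae_le (\<lambda>t. 0) f"
      have "y f \<le> 0"
        by (rule LIMSEQ_le_const[OF lim[OF f(1)]]) (use y f in \<open>auto simp: dual_le_def\<close>)
      then show "y f \<le> (\<lambda>f\<in>X. 0) f" using f by simp
    qed
  qed
  \<comment> \<open>This net is indexed by natural numbers, while order continuity is defined with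
    index sets of functionals; the reindexing lemma bridges the two.\<close>
  have "net_norm_null (dual_norm X N) (UNIV :: nat set) (\<le>) (\<lambda>n. functional (G n))"
    by (rule order_continuous_norm_any_index[OF oc[unfolded associate_order_continuous_def] _ _ net])
       (unfold dual_le_def, (meson order_refl order_trans)+)
  then obtain n where n: "dual_norm X N (functional (G n)) < e"
    using e unfolding net_norm_null_def by blast
  show ?thesis
  proof (intro exI ballI)
    fix f assume f: "f \<in> X"
    have "(\<integral>t. \<bar>f t * g t\<bar> * indicator (A n) t \<partial>unit_leb) = functional (G n) (\<lambda>t. \<bar>f t\<bar>)"
      unfolding functional_apply[OF abs_mem[OF f]] by (simp add: G_def abs_mult mult.assoc)
    also have "\<dots> \<le> dual_norm X N (functional (G n)) * N f"
      using abs_le_dual_norm[OF functional_norm_dual[OF mc G] abs_mem[OF f], of n] norm_abs[OF f]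
      by simp
    also have "\<dots> \<le> e * N f" using n norm_nonneg[OF f] by (intro mult_right_mono) auto
    finally show "(\<integral>t. \<bar>f t * g t\<bar> * indicator (A n) t \<partial>unit_leb) \<le> e * N f" .
  qed
qed

text \<open>An Egorov argument with a weight. Off the exceptional set \<open>A n\<close> the error
  is at most \<open>d * H\<close>, whose integral against \<open>g\<close> is small; on
  \<open>A n\<close> the uniform estimate of \<open>assoc_absolutely_continuous\<close> takes
  over.\<close>

lemma AE_limit_weak:
  fixes y :: "nat \<Rightarrow> real \<Rightarrow> real"
  assumes mc: "monotonically_complete X N" and oc: "associate_order_continuous X N"
    and y: "\<And>n. y n \<in> X" and C: "\<And>n. N (y n) \<le> C" and z: "z \<in> X"
    and lim: "AE t in unit_leb. (\<lambda>n. y n t) \<longlonglongrightarrow> z t"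
    and g: "g \<in> associate_space X"
  shows "(\<lambda>n. \<integral>t. y n t * g t \<partial>unit_leb) \<longlonglongrightarrow> (\<integral>t. z t * g t \<partial>unit_leb)"
proof (rule LIMSEQ_I)
  fix e :: real assume e: "e > 0"
  obtain h where h: "h \<in> X" "AE t in unit_leb. \<forall>n. \<bar>y n t\<bar> \<le> 2 ^ n * h t"
    by (rule dominating_element[OF mc y C])
  \<comment> \<open>Up to a null set, \<open>H\<close> vanishes only where all \<open>y n\<close>
    and \<open>z\<close> vanish. So a tolerance proportional to \<open>H\<close> is integrable
    against \<open>g\<close>, and almost every point still leaves the sets \<open>A n\<close> built
    from it.\<close>
  define H where "H t = \<bar>h t\<bar> + \<bar>z t\<bar>" for t
  have H: "H \<in> X" unfolding H_def[abs_def] by (intro add_mem abs_mem h z)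
  have H0: "0 \<le> H t" for t by (simp add: H_def)
  define I where "I = (\<integral>t. \<bar>H t * g t\<bar> \<partial>unit_leb)"
  have I: "0 \<le> I" unfolding I_def by simp
  \<comment> \<open>The tolerance makes the part off \<open>A n\<close> cost less than
    \<open>e / 2\<close>, and adding \<open>1\<close> keeps the denominator positive. The factor
    \<open>e / (2 * (D + 1))\<close> below does the same for the part on \<open>A n\<close>.\<close>
  define d where "d = e / (2 * (I + 1))"
  have d: "d > 0" using e I by (simp add: d_def)
  have dI: "d * I < e / 2"
  proof -
    have "d * I < d * (I + 1)" using d by simp
    also have "\<dots> = e / 2" using I by (simp add: d_def field_simps)
    finally show ?thesis .
  qed
  define D where "D = C + N z"
  have C0: "0 \<le> C" using norm_nonneg[OF y[of 0]] C[of 0] by linarith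
  have D0: "0 \<le> D" using norm_nonneg[OF z] C0 by (simp add: D_def)
  define A where "A n = {t \<in> space unit_leb. \<exists>k\<in>{n..}. d * H t < \<bar>y k t - z t\<bar>}" for n
  have [measurable]: "y n \<in> borel_measurable unit_leb" "z \<in> borel_measurable unit_leb"
    "H \<in> borel_measurable unit_leb" "g \<in> borel_measurable unit_leb" for n
    using y z H g by (auto intro: meas assoc_meas)
  have A [measurable]: "A n \<in> sets unit_leb" for n unfolding A_def by measurable
  have "\<exists>n. \<forall>f\<in>X. (\<integral>t. \<bar>f t * g t\<bar> * indicator (A n) t \<partial>unit_leb) \<le> (e / (2 * (D + 1))) * N f"
  proof (rule assoc_absolutely_continuous[OF mc oc g A])
    show "A (Suc n) \<subseteq> A n" for n by (auto simp: A_def)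
    show "0 < e / (2 * (D + 1))" using e D0 by simp
    show "AE t in unit_leb. \<exists>n. t \<notin> A n"
      using h(2) lim
    proof eventually_elim
      case (elim t)
      show ?case
      proof (cases "H t = 0")
        case True
        then have "z t = 0" "h t = 0" by (auto simp: H_def)
        with elim(1) have "y k t = 0" for k by (metis abs_le_zero_iff mult_zero_right)
        with \<open>z t = 0\<close> True have "t \<notin> A 0" by (auto simp: A_def)
        then show ?thesis by blast
      next
        case False
        with H0[of t] d have "0 < d * H t" by simp
        from LIMSEQ_D[OF elim(2) this] obtain n
          where "\<forall>k\<ge>n. norm (y k t - z t) < d * H t" by blast
        then have "t \<notin> A n" by (fastforce simp: A_def)
        then show ?thesis by blast
      qed
    qed
  qed
  then obtain n where n: "\<And>f. f \<in> X \<Longrightarrow>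
      (\<integral>t. \<bar>f t * g t\<bar> * indicator (A n) t \<partial>unit_leb) \<le> (e / (2 * (D + 1))) * N f"
    by blast
  have Hg: "integrable unit_leb (\<lambda>t. \<bar>H t * g t\<bar>)" using assoc_integrable[OF g H] by simp
  show "\<exists>n. \<forall>k\<ge>n. norm ((\<integral>t. y k t * g t \<partial>unit_leb) - (\<integral>t. z t * g t \<partial>unit_leb)) < e"
  proof (intro exI allI impI)
    fix k assume k: "n \<le> k"
    define u where "u t = y k t - z t" for t
    have u: "u \<in> X" unfolding u_def[abs_def] by (intro diff_mem y z)
    have "N u \<le> D"
    proof -
      have "N (\<lambda>t. y k t + (-1) * z t) \<le> N (y k) + N (\<lambda>t. (-1) * z t)"
        by (intro norm_triangle y scale_mem z)
      with C[of k] norm_scale[OF z, of "-1"] show ?thesis by (simp add: D_def u_def[abs_def])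
    qed
    have ug: "integrable unit_leb (\<lambda>t. \<bar>u t * g t\<bar>)" using assoc_integrable[OF g u] by simp
    have ugA: "integrable unit_leb (\<lambda>t. \<bar>u t * g t\<bar> * indicator (A n) t)"
      by (rule integrable_real_mult_indicator[OF A ug])
    have "(\<integral>t. y k t * g t \<partial>unit_leb) - (\<integral>t. z t * g t \<partial>unit_leb) = (\<integral>t. u t * g t \<partial>unit_leb)"
      using assoc_integrable[OF g y] assoc_integrable[OF g z]
      by (simp add: u_def left_diff_distrib)
    then have "norm ((\<integral>t. y k t * g t \<partial>unit_leb) - (\<integral>t. z t * g t \<partial>unit_leb))
        \<le> (\<integral>t. \<bar>u t * g t\<bar> \<partial>unit_leb)"
      using integral_abs_bound[of unit_leb "\<lambda>t. u t * g t"] by simp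
    also have "\<dots> \<le> (\<integral>t. \<bar>u t * g t\<bar> * indicator (A n) t + d * \<bar>H t * g t\<bar> \<partial>unit_leb)"
    proof (rule integral_mono_AE[OF ug])
      show "integrable unit_leb (\<lambda>t. \<bar>u t * g t\<bar> * indicator (A n) t + d * \<bar>H t * g t\<bar>)"
        using ugA Hg by simp
      show "AE t in unit_leb. \<bar>u t * g t\<bar> \<le> \<bar>u t * g t\<bar> * indicator (A n) t + d * \<bar>H t * g t\<bar>"
      proof (rule AE_I2)
        fix t assume t: "t \<in> space unit_leb"
        show "\<bar>u t * g t\<bar> \<le> \<bar>u t * g t\<bar> * indicator (A n) t + d * \<bar>H t * g t\<bar>"
        proof (cases "t \<in> A n")
          case True
          then show ?thesis using d by simp
        next
          case False
          with t k have "\<bar>u t\<bar> \<le> d * H t" by (auto simp: A_def u_def not_less)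
          then have "\<bar>u t\<bar> * \<bar>g t\<bar> \<le> d * H t * \<bar>g t\<bar>" by (rule mult_right_mono) simp
          with False H0[of t] show ?thesis by (simp add: abs_mult mult.assoc)
        qed
      qed
    qed
    also have "\<dots> = (\<integral>t. \<bar>u t * g t\<bar> * indicator (A n) t \<partial>unit_leb) + d * I"
      unfolding I_def using ugA Hg by (subst Bochner_Integration.integral_add) auto
    also have "\<dots> \<le> (e / (2 * (D + 1))) * N u + d * I" using n[OF u] by simp
    also have "\<dots> \<le> e / 2 + d * I"
    proof -
      have "(e / (2 * (D + 1))) * N u \<le> (e / (2 * (D + 1))) * (D + 1)"
        using e D0 \<open>N u \<le> D\<close> by (intro mult_left_mono) auto
      also have "\<dots> = e / 2" using D0 by (simp add: field_simps)
      finally show ?thesis by simp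
    qed
    also have "\<dots> < e" using dI by simp
    finally show "norm ((\<integral>t. y k t * g t \<partial>unit_leb) - (\<integral>t. z t * g t \<partial>unit_leb)) < e" .
  qed
qed

section \<open>Infima in the associate space and in the norm dual\<close>

text \<open>If the values at \<open>f\<close> had infimum \<open>c > 0\<close>, a sequence of
  indices would attain \<open>c\<close> in the limit. The limit \<open>G\<close> of its densities on
  the support of \<open>f\<close> satisfies \<open>\<integral> f * G = c\<close>, and minimality of
  \<open>c\<close> puts \<open>G\<close> below every density of the net. So \<open>G\<close> induces
  a lower bound that is positive at \<open>f\<close>, which contradicts the zero infimum.\<close>

lemma assoc_net_pointwise_null:
  assumes net: "net_decreases_to (associate_functionals X) (dual_le X) I r x (\<lambda>f\<in>X. 0)"
    and f: "f \<in> X" "AE t in unit_leb. 0 \<le> f t" and e: "e > 0"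
  shows "\<exists>i\<in>I. x i f < e"
proof (rule ccontr)
  assume no: "\<not> ?thesis"
  have dir: "\<And>i j. i \<in> I \<Longrightarrow> j \<in> I \<Longrightarrow> \<exists>k\<in>I. r i k \<and> r j k" and ne: "I \<noteq> {}"
    and x: "\<And>i. i \<in> I \<Longrightarrow> x i \<in> associate_functionals X"
    and dec: "\<And>i j. i \<in> I \<Longrightarrow> j \<in> I \<Longrightarrow> r i j \<Longrightarrow> dual_le X (x j) (x i)"
    and pos: "\<And>i. i \<in> I \<Longrightarrow> dual_le X (\<lambda>f\<in>X. 0) (x i)"
    and inf: "\<And>y. y \<in> associate_functionals X \<Longrightarrow> (\<And>i. i \<in> I \<Longrightarrow> dual_le X y (x i))
      \<Longrightarrow> dual_le X y (\<lambda>f\<in>X. 0)"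
    using net unfolding net_decreases_to_def directed_index_def by blast+
  have "\<forall>i. \<exists>g. i \<in> I \<longrightarrow> g \<in> associate_space X \<and> x i = functional g"
    using x unfolding associate_functionals_eq by blast
  from choice[OF this] obtain g where g: "\<And>i. i \<in> I \<Longrightarrow> g i \<in> associate_space X"
    and xg: "\<And>i. i \<in> I \<Longrightarrow> x i = functional (g i)" by blast
  have zero: "(\<lambda>t. 0) \<in> associate_space X" by (simp add: associate_space_def)
  have g_pos: "AE t in unit_leb. 0 < p t \<longrightarrow> 0 \<le> g i t" if "i \<in> I" "p \<in> X" for i p
    using functional_le_AE[OF zero g[OF that(1)] that(2)] pos[OF that(1)] xg[OF that(1)]
    by (simp add: functional_zero)
  have g_dec: "AE t in unit_leb. 0 < f t \<longrightarrow> g j t \<le> g i t" if "i \<in> I" "j \<in> I" "r i j" for i j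
    using functional_le_AE[OF g[OF that(2)] g[OF that(1)] f(1)] dec[OF that] xg that by simp
  define c where "c = (INF i\<in>I. x i f)"
  have bdd: "bdd_below ((\<lambda>i. x i f) ` I)" using no by (intro bdd_belowI[of _ e]) auto
  have c_le: "c \<le> x i f" if "i \<in> I" for i unfolding c_def by (rule cINF_lower[OF bdd that])
  have "e \<le> c" unfolding c_def using ne no by (intro cINF_greatest) auto
  have near: "\<exists>i\<in>I. x i f < c + d" if "d > 0" for d
  proof (rule ccontr)
    assume "\<not> (\<exists>i\<in>I. x i f < c + d)"
    then have "c + d \<le> (INF i\<in>I. x i f)" using ne by (intro cINF_greatest) auto
    then have "c + d \<le> c" by (simp only: c_def[symmetric])
    with that show False by simp
  qed
  \<comment> \<open>Directedness pushes nearly minimising indices upwards into an increasing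
    sequence; moving up only lowers the values at \<open>f\<close>, so they stay nearly
    minimal.\<close>
  obtain a where a: "\<And>n::nat. a n \<in> I" and a_inc: "\<And>n. r (a n) (a (Suc n))"
    and a_near: "\<And>n. x (a n) f < c + 1 / real (Suc n)"
  proof -
    have "\<exists>a. \<forall>n. (a n \<in> I \<and> x (a n) f < c + 1 / real (Suc n)) \<and> r (a n) (a (Suc n))"
    proof (rule dependent_nat_choice)
      show "\<exists>i. i \<in> I \<and> x i f < c + 1 / real (Suc 0)" using near[of 1] by auto
      fix i n assume i: "i \<in> I \<and> x i f < c + 1 / real (Suc n)"
      obtain j where j: "j \<in> I" "x j f < c + 1 / real (Suc (Suc n))"
        using near[of "1 / real (Suc (Suc n))"] by auto
      obtain k where k: "k \<in> I" "r i k" "r j k" using dir i j(1) by blast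
      have "x k f \<le> x j f" using dec[OF j(1) k(1) k(3)] f by (auto simp: dual_le_def ae_le_def)
      with j(2) k show "\<exists>k. (k \<in> I \<and> x k f < c + 1 / real (Suc (Suc n))) \<and> r i k" by auto
    qed
    then show thesis using that by blast
  qed
  have x_lim: "(\<lambda>n. x (a n) f) \<longlonglongrightarrow> c"
  proof (rule tendsto_sandwich[OF _ _ tendsto_const])
    show "(\<lambda>n. c + 1 / real (Suc n)) \<longlonglongrightarrow> c"
      using tendsto_add[OF tendsto_const LIMSEQ_inverse_real_of_nat, of c]
      by (simp add: inverse_eq_divide)
  qed (rule always_eventually, rule allI, (rule less_imp_le[OF a_near] | rule c_le[OF a]))+
  define S where "S = {t \<in> space unit_leb. 0 < f t}"
  \<comment> \<open>The densities are known to be nonnegative and decreasing only where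
    \<open>f\<close> is positive, so \<open>G\<close> is cut off outside \<open>S\<close>. The
    truncation at \<open>0\<close> makes the infimum exist at every point.\<close>
  define G where "G t = (INF n. max 0 (g (a n) t)) * indicator S t" for t
  have [measurable]: "f \<in> borel_measurable unit_leb" using f(1) by (rule meas)
  have gm [measurable]: "g i \<in> borel_measurable unit_leb" if "i \<in> I" for i
    using g[OF that] by (rule assoc_meas)
  have [measurable]: "S \<in> sets unit_leb" unfolding S_def by measurable
  have Gm [measurable]: "G \<in> borel_measurable unit_leb"
    unfolding G_def[abs_def] using a by measurable
  have ga: "AE t in unit_leb. 0 < f t \<longrightarrow> (\<forall>n. 0 \<le> g (a n) t \<and> g (a (Suc n)) t \<le> g (a n) t)"
  proof -
    have "AE t in unit_leb. \<forall>n. 0 < f t \<longrightarrow> 0 \<le> g (a n) t \<and> g (a (Suc n)) t \<le> g (a n) t"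
      unfolding AE_all_countable
    proof
      fix n
      show "AE t in unit_leb. 0 < f t \<longrightarrow> 0 \<le> g (a n) t \<and> g (a (Suc n)) t \<le> g (a n) t"
        using g_pos[OF a f(1), of n] g_dec[OF a a a_inc, of n] by eventually_elim blast
    qed
    then show ?thesis by eventually_elim blast
  qed
  have bddG: "bdd_below (range (\<lambda>n. max 0 (g (a n) t)))" for t by (intro bdd_belowI[of _ 0]) auto
  have G0: "0 \<le> G t" for t
    unfolding G_def by (intro mult_nonneg_nonneg cINF_greatest) auto
  have G_le: "G t \<le> max 0 (g (a n) t)" for n t
  proof -
    have "(INF n. max 0 (g (a n) t)) \<le> max 0 (g (a n) t)" by (rule cINF_lower[OF bddG]) simp
    then show ?thesis by (simp add: G_def indicator_def)
  qed
  have G_lim: "AE t in unit_leb. 0 < f t \<longrightarrow> (\<lambda>n. g (a n) t) \<longlonglongrightarrow> G t"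
    using ga AE_space
  proof eventually_elim
    case (elim t)
    show ?case
    proof
      assume ft: "0 < f t"
      have eq: "max 0 (g (a n) t) = g (a n) t" for n using elim ft by auto
      have "decseq (\<lambda>n. max 0 (g (a n) t))"
        unfolding eq using elim ft by (intro decseq_SucI) auto
      from LIMSEQ_decseq_INF[OF bddG this] show "(\<lambda>n. g (a n) t) \<longlonglongrightarrow> G t"
        using ft elim by (simp add: eq G_def S_def)
    qed
  qed
  have G_assoc: "G \<in> associate_space X"
  proof (rule assoc_solid[OF g[OF a[of 0]] Gm])
    show "AE t in unit_leb. \<bar>G t\<bar> \<le> \<bar>g (a 0) t\<bar>"
      by (rule AE_I2) (use G0 G_le[of _ 0] in \<open>smt (verit)\<close>)
  qed
  have intG: "(\<integral>t. f t * G t \<partial>unit_leb) = c"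
  proof (rule LIMSEQ_unique[OF _ x_lim])
    have "(\<lambda>n. \<integral>t. f t * g (a n) t \<partial>unit_leb) \<longlonglongrightarrow> (\<integral>t. f t * G t \<partial>unit_leb)"
    proof (rule integral_dominated_convergence)
      show "integrable unit_leb (\<lambda>t. \<bar>f t * g (a 0) t\<bar>)"
        using assoc_integrable[OF g[OF a] f(1)] by simp
      show "AE t in unit_leb. (\<lambda>n. f t * g (a n) t) \<longlonglongrightarrow> f t * G t"
        using G_lim f(2) by eventually_elim (auto simp: order_le_less intro: tendsto_mult_left)
      show "AE t in unit_leb. norm (f t * g (a n) t) \<le> \<bar>f t * g (a 0) t\<bar>" for n
        using ga f(2)
      proof eventually_elim
        case (elim t)
        show ?case
        proof (cases "0 < f t")
          case True
          then have "decseq (\<lambda>n. g (a n) t)" using elim by (intro decseq_SucI) auto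
          then have "g (a n) t \<le> g (a 0) t" by (rule decseqD) simp
          moreover have "0 \<le> g (a n) t" using elim True by blast
          ultimately show ?thesis by (simp add: abs_mult mult_left_mono)
        qed (use elim in auto)
      qed
    qed (use a in measurable)
    then show "(\<lambda>n. x (a n) f) \<longlonglongrightarrow> (\<integral>t. f t * G t \<partial>unit_leb)"
      by (simp add: xg a functional_apply f)
  qed
  \<comment> \<open>A common successor of \<open>a n\<close> and \<open>i\<close> has a density
    below both on the support of \<open>f\<close> and value at least \<open>c\<close> at
    \<open>f\<close>. In the limit \<open>min (G t) (g i t)\<close> integrates against
    \<open>f\<close> to at least \<open>c = \<integral> f * G\<close>, so it equals \<open>G\<close>
    where \<open>f\<close> is positive.\<close>
  have G_lower: "AE t in unit_leb. 0 < f t \<longrightarrow> G t \<le> g i t" if i: "i \<in> I" for i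
  proof -
    have int_min: "integrable unit_leb (\<lambda>t. f t * min (h t) (g i t))"
      if h: "h \<in> associate_space X" for h
    proof (rule Bochner_Integration.integrable_bound)
      show "integrable unit_leb (\<lambda>t. \<bar>f t * h t\<bar> + \<bar>f t * g i t\<bar>)"
        using assoc_integrable[OF h f(1)] assoc_integrable[OF g[OF i] f(1)] by simp
      show "(\<lambda>t. f t * min (h t) (g i t)) \<in> borel_measurable unit_leb"
        using assoc_meas[OF h] i by measurable
      show "AE t in unit_leb. norm (f t * min (h t) (g i t)) \<le> norm (\<bar>f t * h t\<bar> + \<bar>f t * g i t\<bar>)"
        by (auto simp: min_def)
    qed
    have "(\<lambda>n. \<integral>t. f t * min (g (a n) t) (g i t) \<partial>unit_leb) \<longlonglongrightarrow> (\<integral>t. f t * min (G t) (g i t) \<partial>unit_leb)"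
    proof (rule integral_dominated_convergence)
      show "integrable unit_leb (\<lambda>t. \<bar>f t * g (a 0) t\<bar>)"
        using assoc_integrable[OF g[OF a] f(1)] by simp
      show "AE t in unit_leb. (\<lambda>n. f t * min (g (a n) t) (g i t)) \<longlonglongrightarrow> f t * min (G t) (g i t)"
        using G_lim f(2)
      proof eventually_elim
        case (elim t)
        show ?case
        proof (cases "f t = 0")
          case False
          with elim have "(\<lambda>n. g (a n) t) \<longlonglongrightarrow> G t" by simp
          then show ?thesis by (intro tendsto_mult_left tendsto_min tendsto_const)
        qed simp
      qed
      show "AE t in unit_leb. norm (f t * min (g (a n) t) (g i t)) \<le> \<bar>f t * g (a 0) t\<bar>" for n
        using ga g_pos[OF i f(1)] f(2)
      proof eventually_elim
        case (elim t)
        show ?case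
        proof (cases "0 < f t")
          case True
          then have "decseq (\<lambda>n. g (a n) t)" using elim by (intro decseq_SucI) auto
          then have "g (a n) t \<le> g (a 0) t" by (rule decseqD) simp
          moreover have "0 \<le> g (a n) t" "0 \<le> g i t" using elim True by blast+
          ultimately have "\<bar>min (g (a n) t) (g i t)\<bar> \<le> \<bar>g (a 0) t\<bar>" by simp
          then show ?thesis by (simp add: abs_mult mult_left_mono)
        qed (use elim in auto)
      qed
    qed (use a i in measurable)
    then have "c \<le> (\<integral>t. f t * min (G t) (g i t) \<partial>unit_leb)"
    proof (rule LIMSEQ_le_const, intro exI allI impI)
      fix n :: nat
      obtain k where k: "k \<in> I" "r (a n) k" "r i k" using dir a i by blast
      have "c \<le> x k f" by (rule c_le[OF k(1)])
      also have "\<dots> = (\<integral>t. f t * g k t \<partial>unit_leb)" by (simp add: xg k functional_apply f)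
      also have "\<dots> \<le> (\<integral>t. f t * min (g (a n) t) (g i t) \<partial>unit_leb)"
      proof (rule integral_mono_AE[OF assoc_integrable[OF g[OF k(1)] f(1)] int_min[OF g[OF a]]])
        show "AE t in unit_leb. f t * g k t \<le> f t * min (g (a n) t) (g i t)"
          using g_dec[OF a k(1,2)] g_dec[OF i k(1,3)] f(2)
          by eventually_elim (auto simp: order_le_less)
      qed
      finally show "c \<le> (\<integral>t. f t * min (g (a n) t) (g i t) \<partial>unit_leb)" .
    qed
    moreover have diff: "integrable unit_leb (\<lambda>t. f t * G t - f t * min (G t) (g i t))"
      using assoc_integrable[OF G_assoc f(1)] int_min[OF G_assoc] by simp
    moreover have nn: "AE t in unit_leb. 0 \<le> f t * G t - f t * min (G t) (g i t)"
      using f(2) by eventually_elim (simp add: mult_left_mono)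
    ultimately have "(\<integral>t. f t * G t - f t * min (G t) (g i t) \<partial>unit_leb) = 0"
      using integral_nonneg_AE[OF nn] assoc_integrable[OF G_assoc f(1)] int_min[OF G_assoc] intG
      by simp
    then have "AE t in unit_leb. f t * G t - f t * min (G t) (g i t) = 0"
      using integral_nonneg_eq_0_iff_AE[OF diff nn] by blast
    then show ?thesis by eventually_elim (auto simp: min_def split: if_splits)
  qed
  have "dual_le X (functional G) (\<lambda>f\<in>X. 0)"
  proof (rule inf)
    show "functional G \<in> associate_functionals X" using G_assoc by (simp add: associate_functionals_eq)
    fix i assume i: "i \<in> I"
    show "dual_le X (functional G) (x i)"
      unfolding xg[OF i] dual_le_def ae_le_def
    proof (intro ballI impI)
      fix p assume p: "p \<in> X" "AE t in unit_leb. 0 \<le> p t"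
      have "AE t in unit_leb. 0 < p t \<longrightarrow> G t \<le> g i t"
        using g_pos[OF i p(1)] G_lower[OF i] by eventually_elim (auto simp: G_def S_def indicator_def)
      then show "functional G p \<le> functional (g i) p"
        by (rule functional_mono_AE[OF G_assoc g[OF i] p])
    qed
  qed
  then have "c \<le> 0" using f intG by (auto simp: dual_le_def ae_le_def functional_apply)
  with \<open>e \<le> c\<close> e show False by simp
qed

text \<open>The norm dual may admit more lower bounds than the associate space, so the zero infimum
  has to be carried over. Arbitrarily small values at each nonnegative \<open>f\<close> exclude any
  lower bound positive at \<open>f\<close>.\<close>

lemma associate_net_decreases_in_dual:
  assumes mc: "monotonically_complete X N"
    and net: "net_decreases_to (associate_functionals X) (dual_le X) I r x (\<lambda>f\<in>X. 0)"
  shows "net_decreases_to (norm_dual X N) (dual_le X) I r x (\<lambda>f\<in>X. 0)"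
proof -
  have sub: "associate_functionals X \<subseteq> norm_dual X N"
    using functional_norm_dual[OF mc] by (auto simp: associate_functionals_eq)
  have "dual_le X y (\<lambda>f\<in>X. 0)" if y: "\<forall>i\<in>I. dual_le X y (x i)" for y
    unfolding dual_le_def
  proof (intro ballI impI)
    fix f assume f: "f \<in> X" "ae_le (\<lambda>t. 0) f"
    have "y f \<le> 0"
    proof (rule field_le_epsilon)
      fix e :: real assume "e > 0"
      then obtain i where "i \<in> I" "x i f < e"
        using assoc_net_pointwise_null[OF net f(1)] f(2) by (auto simp: ae_le_def)
      moreover from this have "y f \<le> x i f" using y f by (auto simp: dual_le_def)
      ultimately show "y f \<le> 0 + e" by simp
    qed
    with f show "y f \<le> (\<lambda>f\<in>X. 0) f" by simp
  qed
  with net sub show ?thesis unfolding net_decreases_to_def by blast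
qed

lemma norm_dual_oc_imp_associate_oc:
  assumes mc: "monotonically_complete X N" and oc: "norm_dual_order_continuous X N"
  shows "associate_order_continuous X N"
  unfolding associate_order_continuous_def order_continuous_norm_def
proof (intro allI impI)
  fix I :: "((real \<Rightarrow> real) \<Rightarrow> real) set" and r x
  assume "net_decreases_to (associate_functionals X) (dual_le X) I r x (\<lambda>f\<in>X. 0)"
  from associate_net_decreases_in_dual[OF mc this] show "net_norm_null (dual_norm X N) I r x"
    using oc unfolding norm_dual_order_continuous_def order_continuous_norm_def by blast
qed


subsection \<open>Order continuity of the dual\<close>

lemma dual_add: "\<phi> \<in> norm_dual X N \<Longrightarrow> f \<in> X \<Longrightarrow> g \<in> X \<Longrightarrow> \<phi> (\<lambda>t. f t + g t) = \<phi> f + \<phi> g"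
  by (auto simp: norm_dual_def)

lemma dual_scale: "\<phi> \<in> norm_dual X N \<Longrightarrow> f \<in> X \<Longrightarrow> \<phi> (\<lambda>t. c * f t) = c * \<phi> f"
  by (auto simp: norm_dual_def)

lemma dual_diff:
  assumes "\<phi> \<in> norm_dual X N" "f \<in> X" "g \<in> X"
  shows "\<phi> (\<lambda>t. f t - g t) = \<phi> f - \<phi> g"
  using dual_add[OF assms(1,2) scale_mem[OF assms(3), of "-1"]] dual_scale[OF assms(1,3), of "-1"]
  by simp

lemma dual_sum:
  assumes "\<phi> \<in> norm_dual X N" "\<And>i. i \<in> I \<Longrightarrow> f i \<in> X"
  shows "\<phi> (\<lambda>t. \<Sum>i\<in>I. f i t) = (\<Sum>i\<in>I. \<phi> (f i))"
  using assms(2)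
proof (induction I rule: infinite_finite_induct)
  case (insert i I)
  have "\<phi> (\<lambda>t. f i t + (\<Sum>j\<in>I. f j t)) = \<phi> (f i) + \<phi> (\<lambda>t. \<Sum>j\<in>I. f j t)"
    using insert by (intro dual_add[OF assms(1)] sum_mem) auto
  with insert show ?case by simp
qed (simp_all add: dual_zero_mem[OF assms(1)])

lemma dual_mono:
  assumes \<phi>: "\<phi> \<in> norm_dual X N" "dual_le X (\<lambda>f\<in>X. 0) \<phi>" and f: "f \<in> X" "g \<in> X"
    and le: "AE t in unit_leb. f t \<le> g t"
  shows "\<phi> f \<le> \<phi> g"
proof -
  have "0 \<le> \<phi> (\<lambda>t. g t - f t)"
    using \<phi>(2) diff_mem[OF f(2,1)] le by (auto simp: dual_le_def ae_le_def)
  then show ?thesis by (simp add: dual_diff[OF \<phi>(1) f(2,1)])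
qed

text \<open>
  An order bound for the Cesaro means of a disjoint sequence \<open>y\<close> dominates
  \<open>\<Sum>n. y n / (n + 1)\<close>, so the divergence of the harmonic series keeps a positive functional
  from staying away from zero along \<open>y\<close>.
\<close>

lemma oBSP_disjoint:
  fixes y :: "nat \<Rightarrow> real \<Rightarrow> real"
  assumes oBSP: "oBSP X N" and \<phi>: "\<phi> \<in> norm_dual X N" "dual_le X (\<lambda>f\<in>X. 0) \<phi>"
    and y: "\<And>n. y n \<in> X" and C: "\<And>n. N (y n) \<le> C" and pos: "\<And>n t. 0 \<le> y n t"
    and disj: "AE t in unit_leb. \<forall>m n. m < n \<longrightarrow> y m t = 0 \<or> y n t = 0"
    and \<delta>: "\<delta> > 0" "\<And>n. \<delta> \<le> \<phi> (y n)"
  shows False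
proof -
  have "norm_bounded_seq X N y" using y C by (auto simp: norm_bounded_seq_def)
  then obtain s l where s: "strict_mono (s :: nat \<Rightarrow> nat)"
    and conv: "order_converges X (cesaro (y \<circ> s)) l"
    using oBSP unfolding oBSP_def has_order_cesaro_subseq_def by blast
  obtain h where h: "h \<in> X" "\<And>n. AE t in unit_leb. \<bar>cesaro (y \<circ> s) n t\<bar> \<le> h t"
    using conv by (rule order_converges_bounded) blast
  define p where "p M = (\<lambda>t. \<Sum>n\<le>M. (1 / real (Suc n)) * y (s n) t)" for M
  have p: "p M \<in> X" for M unfolding p_def by (intro sum_mem scale_mem y)
  have h_all: "AE t in unit_leb. \<forall>n. \<bar>cesaro (y \<circ> s) n t\<bar> \<le> h t"
    using h(2) by (simp add: AE_all_countable)
  have p_le: "AE t in unit_leb. p M t \<le> h t" for M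
    using h_all disj
  proof eventually_elim
    case (elim t)
    have h0: "0 \<le> h t" using elim(1) by (meson abs_ge_zero order_trans)
    show ?case
    proof (cases "\<exists>k\<le>M. y (s k) t \<noteq> 0")
      case False
      then show ?thesis using h0 by (simp add: p_def)
    next
      case True
      then obtain k where k: "k \<le> M" "y (s k) t \<noteq> 0" by blast
      have other: "y (s j) t = 0" if "j \<noteq> k" for j
      proof -
        have "s j < s k \<or> s k < s j"
          using that strict_mono_eq[OF s] by (meson linorder_neqE_nat)
        with elim(2) k(2) show ?thesis by blast
      qed
      \<comment> \<open>By disjointness only the term of index \<open>k\<close> is nonzero at
        \<open>t\<close>, and its weight in \<open>p M\<close> is exactly its weight in the
        \<open>k\<close>-th Cesaro mean.\<close>
      have "p M t = (\<Sum>n\<in>{k}. (1 / real (Suc n)) * y (s n) t)"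
        unfolding p_def using k other by (intro sum.mono_neutral_right) auto
      also have "\<dots> = y (s k) t / real (Suc k)" by simp
      also have "\<dots> \<le> cesaro (y \<circ> s) k t"
        unfolding cesaro_def using member_le_sum[of k "{..k}" "\<lambda>n. y (s n) t"] pos
        by (simp add: divide_right_mono)
      also have "\<dots> \<le> h t" using elim(1) by (meson abs_le_D1)
      finally show ?thesis .
    qed
  qed
  have le: "\<delta> * harm (Suc M) \<le> \<phi> h" for M
  proof -
    have "\<delta> * harm (Suc M) = (\<Sum>n\<le>M. (1 / real (Suc n)) * \<delta>)"
      by (simp add: harm_altdef sum_distrib_left inverse_eq_divide lessThan_Suc_atMost del: of_nat_Suc
            sum.lessThan_Suc)
    also have "\<dots> \<le> (\<Sum>n\<le>M. (1 / real (Suc n)) * \<phi> (y (s n)))"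
      using \<delta>(2) by (intro sum_mono mult_left_mono) auto
    also have "\<dots> = \<phi> (p M)"
      unfolding p_def by (simp only: dual_sum[OF \<phi>(1) scale_mem[OF y]] dual_scale[OF \<phi>(1) y])
    also have "\<dots> \<le> \<phi> h" by (rule dual_mono[OF \<phi> p h(1) p_le])
    finally show ?thesis .
  qed
  have "filterlim (harm :: nat \<Rightarrow> real) at_top sequentially" by (rule harm_at_top)
  then have "eventually (\<lambda>n. \<phi> h / \<delta> + 1 \<le> harm n) sequentially"
    by (simp add: filterlim_at_top)
  then obtain M0 where "\<And>M. M \<ge> M0 \<Longrightarrow> \<phi> h / \<delta> + 1 \<le> harm M"
    unfolding eventually_sequentially by blast
  from this[of "Suc M0"] have "\<phi> h / \<delta> + 1 \<le> harm (Suc M0)" by simp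
  with le[of M0] \<delta>(1) show False by (simp add: field_simps)
qed

text \<open>The pointwise limit \<open>\<psi>\<close> of the net exists: by monotonicity at
  nonnegative functions, by splitting into positive and negative parts in general. It is a bounded
  functional and a lower bound, hence nonpositive at \<open>f\<close>; values staying above
  \<open>e\<close> would give \<open>e \<le> \<psi> f\<close>.\<close>

lemma dual_net_pointwise_null:
  assumes net: "net_decreases_to (norm_dual X N) (dual_le X) I r x (\<lambda>f\<in>X. 0)"
    and f: "f \<in> X" "AE t in unit_leb. 0 \<le> f t" and e: "e > 0"
  shows "\<exists>i\<in>I. x i f < e"
proof (rule ccontr)
  assume no: "\<not> ?thesis"
  have dir: "\<And>i j. i \<in> I \<Longrightarrow> j \<in> I \<Longrightarrow> \<exists>k\<in>I. r i k \<and> r j k" and ne: "I \<noteq> {}"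
    and refl: "\<And>i. i \<in> I \<Longrightarrow> r i i"
    and tr: "\<And>i j k. i \<in> I \<Longrightarrow> j \<in> I \<Longrightarrow> k \<in> I \<Longrightarrow> r i j \<Longrightarrow> r j k \<Longrightarrow> r i k"
    and x: "\<And>i. i \<in> I \<Longrightarrow> x i \<in> norm_dual X N"
    and dec: "\<And>i j. i \<in> I \<Longrightarrow> j \<in> I \<Longrightarrow> r i j \<Longrightarrow> dual_le X (x j) (x i)"
    and pos: "\<And>i. i \<in> I \<Longrightarrow> dual_le X (\<lambda>f\<in>X. 0) (x i)"
    and inf: "\<And>y. y \<in> norm_dual X N \<Longrightarrow> (\<And>i. i \<in> I \<Longrightarrow> dual_le X y (x i))
      \<Longrightarrow> dual_le X y (\<lambda>f\<in>X. 0)"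
    using net unfolding net_decreases_to_def directed_index_def by blast+
  \<comment> \<open>The filter of tails of the net, so that limits along \<open>F\<close> are limits
    of the net.\<close>
  define F where "F = (INF i\<in>I. principal {j \<in> I. r i j})"
  have ev: "eventually P F \<longleftrightarrow> (\<exists>i\<in>I. \<forall>j\<in>I. r i j \<longrightarrow> P j)" for P
    unfolding F_def
  proof (subst eventually_INF_base)
    show "\<exists>k\<in>I. principal {l \<in> I. r k l} \<le> inf (principal {l \<in> I. r i l}) (principal {l \<in> I. r j l})"
      if ij: "i \<in> I" "j \<in> I" for i j
    proof -
      obtain k where k: "k \<in> I" "r i k" "r j k" using dir[OF ij] by blast
      have "{l \<in> I. r k l} \<subseteq> {l \<in> I. r i l} \<inter> {l \<in> I. r j l}"
        using tr[OF ij(1) k(1) _ k(2)] tr[OF ij(2) k(1) _ k(3)] by blast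
      then show ?thesis using k(1) by auto
    qed
  qed (auto simp: ne eventually_principal)
  have F: "F \<noteq> bot"
    unfolding trivial_limit_def[symmetric] using refl ne by (auto simp: trivial_limit_def ev)
  have le: "x j p \<le> x i p" if "i \<in> I" "j \<in> I" "r i j" "p \<in> X" "AE t in unit_leb. 0 \<le> p t" for i j p
    using dec that by (auto simp: dual_le_def ae_le_def)
  have ge0: "0 \<le> x i p" if "i \<in> I" "p \<in> X" "AE t in unit_leb. 0 \<le> p t" for i p
    using pos that by (auto simp: dual_le_def ae_le_def)
  have conv_pos: "\<exists>L. ((\<lambda>i. x i p) \<longlongrightarrow> L) F" if p: "p \<in> X" "AE t in unit_leb. 0 \<le> p t" for p
  proof
    define c where "c = (INF i\<in>I. x i p)"
    have bdd: "bdd_below ((\<lambda>i. x i p) ` I)" using ge0 p by (intro bdd_belowI[of _ 0]) auto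
    have c_le: "c \<le> x i p" if "i \<in> I" for i unfolding c_def by (rule cINF_lower[OF bdd that])
    show "((\<lambda>i. x i p) \<longlongrightarrow> c) F"
    proof (rule order_tendstoI)
      fix a assume a: "a < c"
      show "eventually (\<lambda>i. a < x i p) F"
        unfolding ev using ne c_le a by (meson all_not_in_conv less_le_trans)
    next
      fix a assume "c < a"
      then obtain i where i: "i \<in> I" "x i p < a"
        unfolding c_def using cINF_less_iff[OF ne bdd] by blast
      show "eventually (\<lambda>i. x i p < a) F"
        unfolding ev using i le p by (meson le_less_trans)
    qed
  qed
  have conv: "\<exists>L. ((\<lambda>i. x i p) \<longlongrightarrow> L) F" if p: "p \<in> X" for p
  proof -
    have mem: "(\<lambda>t. max 0 (p t)) \<in> X" "(\<lambda>t. max 0 (- p t)) \<in> X"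
      using pos_part_mem(1)[OF p] pos_part_mem(1)[OF uminus_mem[OF p]] by auto
    obtain L where L: "((\<lambda>i. x i (\<lambda>t. max 0 (p t))) \<longlongrightarrow> L) F"
      using conv_pos[OF mem(1)] by auto
    obtain L' where L': "((\<lambda>i. x i (\<lambda>t. max 0 (- p t))) \<longlongrightarrow> L') F"
      using conv_pos[OF mem(2)] by auto
    have parts: "(\<lambda>t. max 0 (p t) - max 0 (- p t)) = p" by (auto simp: max_def)
    have "x i p = x i (\<lambda>t. max 0 (p t)) - x i (\<lambda>t. max 0 (- p t))" if "i \<in> I" for i
      using dual_diff[OF x[OF that] mem] by (simp only: parts)
    then have "eventually (\<lambda>i. x i (\<lambda>t. max 0 (p t)) - x i (\<lambda>t. max 0 (- p t)) = x i p) F"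
      unfolding ev using ne by auto
    with tendsto_diff[OF L L'] have "((\<lambda>i. x i p) \<longlongrightarrow> L - L') F"
      by (rule Lim_transform_eventually)
    then show ?thesis by blast
  qed
  define \<psi> where "\<psi> = (\<lambda>p\<in>X. Lim F (\<lambda>i. x i p))"
  have lim: "((\<lambda>i. x i p) \<longlongrightarrow> \<psi> p) F" if "p \<in> X" for p
    using conv[OF that] tendsto_Lim[OF F] that by (auto simp: \<psi>_def)
  obtain i0 where i0: "i0 \<in> I" using ne by blast
  have mem: "\<psi> \<in> norm_dual X N"
    unfolding norm_dual_def
  proof (intro CollectI conjI ballI allI)
    show "\<psi> \<in> extensional X" by (simp add: \<psi>_def)
    fix p assume p: "p \<in> X"
    show "\<psi> (\<lambda>t. p t + q t) = \<psi> p + \<psi> q" if q: "q \<in> X" for q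
    proof (rule tendsto_unique[OF F lim[OF add_mem[OF p q]]])
      have "eventually (\<lambda>i. x i p + x i q = x i (\<lambda>t. p t + q t)) F"
        unfolding ev using i0 dual_add[OF x p q] by auto
      with tendsto_add[OF lim[OF p] lim[OF q]]
      show "((\<lambda>i. x i (\<lambda>t. p t + q t)) \<longlongrightarrow> \<psi> p + \<psi> q) F"
        by (rule Lim_transform_eventually)
    qed
    show "\<psi> (\<lambda>t. c * p t) = c * \<psi> p" for c
    proof (rule tendsto_unique[OF F lim[OF scale_mem[OF p]]])
      have "eventually (\<lambda>i. c * x i p = x i (\<lambda>t. c * p t)) F"
        unfolding ev using i0 dual_scale[OF x p] by auto
      with tendsto_mult_left[OF lim[OF p]]
      show "((\<lambda>i. x i (\<lambda>t. c * p t)) \<longlongrightarrow> c * \<psi> p) F"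
        by (rule Lim_transform_eventually)
    qed
  next
    show "\<exists>C. \<forall>p\<in>X. \<bar>\<psi> p\<bar> \<le> C * N p"
    proof (intro exI ballI)
      fix p assume p: "p \<in> X"
      \<comment> \<open>Beyond \<open>i0\<close> the positive functionals of the net lie below
        \<open>x i0\<close>, whose norm thus bounds the limit.\<close>
      have "\<bar>x j p\<bar> \<le> dual_norm X N (x i0) * N p" if j: "j \<in> I" "r i0 j" for j
      proof -
        have "x j p \<le> x j (\<lambda>t. \<bar>p t\<bar>)"
          by (rule dual_mono[OF x[OF j(1)] pos[OF j(1)] p abs_mem[OF p]]) auto
        moreover have "x j (\<lambda>t. (-1) * p t) \<le> x j (\<lambda>t. \<bar>p t\<bar>)"
          by (rule dual_mono[OF x[OF j(1)] pos[OF j(1)] scale_mem[OF p] abs_mem[OF p]]) auto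
        ultimately have "\<bar>x j p\<bar> \<le> x j (\<lambda>t. \<bar>p t\<bar>)" using dual_scale[OF x[OF j(1)] p, of "-1"] by simp
        also have "\<dots> \<le> x i0 (\<lambda>t. \<bar>p t\<bar>)" using le[OF i0 j abs_mem[OF p]] by simp
        also have "\<dots> \<le> dual_norm X N (x i0) * N p"
          using abs_le_dual_norm[OF x[OF i0] abs_mem[OF p]] norm_abs[OF p] by simp
        finally show ?thesis .
      qed
      then have "eventually (\<lambda>j. \<bar>x j p\<bar> \<le> dual_norm X N (x i0) * N p) F"
        unfolding ev using i0 by blast
      with tendsto_upperbound[OF tendsto_rabs[OF lim[OF p]] _ F]
      show "\<bar>\<psi> p\<bar> \<le> dual_norm X N (x i0) * N p" by blast
    qed
  qed
  have "dual_le X \<psi> (\<lambda>f\<in>X. 0)"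
  proof (rule inf[OF mem])
    fix i assume i: "i \<in> I"
    show "dual_le X \<psi> (x i)"
      unfolding dual_le_def ae_le_def
    proof (intro ballI impI)
      fix p assume p: "p \<in> X" "AE t in unit_leb. 0 \<le> p t"
      have "eventually (\<lambda>j. x j p \<le> x i p) F" unfolding ev using i le p by blast
      with tendsto_upperbound[OF lim[OF p(1)] _ F] show "\<psi> p \<le> x i p" by blast
    qed
  qed
  then have "\<psi> f \<le> 0" using f by (auto simp: dual_le_def ae_le_def)
  moreover have "eventually (\<lambda>j. e \<le> x j f) F" unfolding ev using no i0 by (meson not_le)
  then have "e \<le> \<psi> f" using tendsto_lowerbound[OF lim[OF f(1)] _ F] by blast
  ultimately show False using e by simp
qed

text \<open>If the norms do not become small, there are later and later indices \<open>i n\<close>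
  and nonnegative \<open>f n\<close> in the unit ball with \<open>x (i n) (f n) > e / 2\<close>,
  while \<open>x (i (Suc n))\<close> is tiny on the sum of the earlier functions. Trimming the
  \<open>f n\<close> yields disjoint functions on which \<open>x (i 0)\<close> is at least
  \<open>e / 4\<close>, which \<open>oBSP_disjoint\<close> forbids.\<close>

lemma oBSP_imp_norm_dual_oc:
  assumes oBSP: "oBSP X N"
  shows "norm_dual_order_continuous X N"
  unfolding norm_dual_order_continuous_def order_continuous_norm_def
proof (intro allI impI, rule ccontr)
  fix I :: "((real \<Rightarrow> real) \<Rightarrow> real) set" and r x
  assume net: "net_decreases_to (norm_dual X N) (dual_le X) I r x (\<lambda>f\<in>X. 0)"
  assume "\<not> net_norm_null (dual_norm X N) I r x"
  then obtain e where e: "e > 0" and big: "\<And>i. i \<in> I \<Longrightarrow> \<exists>j\<in>I. r i j \<and> e \<le> dual_norm X N (x j)"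
    unfolding net_norm_null_def by (meson not_le)
  have mc: "monotonically_complete X N" by (rule oBSP_imp_monotonically_complete[OF oBSP])
  have dir: "\<And>i j. i \<in> I \<Longrightarrow> j \<in> I \<Longrightarrow> \<exists>k\<in>I. r i k \<and> r j k" and ne: "I \<noteq> {}"
    and refl: "\<And>i. i \<in> I \<Longrightarrow> r i i"
    and tr: "\<And>i j k. i \<in> I \<Longrightarrow> j \<in> I \<Longrightarrow> k \<in> I \<Longrightarrow> r i j \<Longrightarrow> r j k \<Longrightarrow> r i k"
    and x: "\<And>i. i \<in> I \<Longrightarrow> x i \<in> norm_dual X N"
    and dec: "\<And>i j. i \<in> I \<Longrightarrow> j \<in> I \<Longrightarrow> r i j \<Longrightarrow> dual_le X (x j) (x i)"
    and pos: "\<And>i. i \<in> I \<Longrightarrow> dual_le X (\<lambda>f\<in>X. 0) (x i)"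
    using net unfolding net_decreases_to_def directed_index_def by blast+
  have step: "\<exists>j f. j \<in> I \<and> r i j \<and> f \<in> X \<and> (\<forall>t. 0 \<le> f t) \<and> N f \<le> 1 \<and> e / 2 < x j f"
    if i: "i \<in> I" for i
  proof -
    obtain j where j: "j \<in> I" "r i j" "e \<le> dual_norm X N (x j)" using big[OF i] by blast
    then have "e / 2 < dual_norm X N (x j)" using e by simp
    moreover have "{f \<in> X. N f \<le> 1} \<noteq> {}" using zero_mem by (auto intro!: exI[of _ "\<lambda>t. 0"])
    ultimately obtain f where f: "f \<in> X" "N f \<le> 1" "e / 2 < \<bar>x j f\<bar>"
      unfolding dual_norm_def using less_cSUP_iff[OF _ dual_bound[OF x[OF j(1)]]] by blast
    have "x j f \<le> x j (\<lambda>t. \<bar>f t\<bar>)"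
      by (rule dual_mono[OF x[OF j(1)] pos[OF j(1)] f(1) abs_mem[OF f(1)]]) auto
    moreover have "x j (\<lambda>t. (-1) * f t) \<le> x j (\<lambda>t. \<bar>f t\<bar>)"
      by (rule dual_mono[OF x[OF j(1)] pos[OF j(1)] scale_mem[OF f(1)] abs_mem[OF f(1)]]) auto
    ultimately have "e / 2 < x j (\<lambda>t. \<bar>f t\<bar>)"
      using f(3) dual_scale[OF x[OF j(1)] f(1), of "-1"] by simp
    then show ?thesis using j f abs_mem norm_abs
      by (intro exI[of _ j] exI[of _ "\<lambda>t. \<bar>f t\<bar>"]) auto
  qed
  \<comment> \<open>A state consists of an index, a test function and a running sum
    \<open>S\<close>. In \<open>Q\<close> the value of the next functional at \<open>S\<close> is
    below \<open>e / (8 * 4 ^ n)\<close>, so that multiplying \<open>S\<close> by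
    \<open>4 ^ n\<close> later costs at most \<open>e / 8\<close>. The initial \<open>S\<close> is
    an arbitrary nonnegative element, so \<open>S n\<close> is only known to dominate
    \<open>f 1\<close>, ..., \<open>f n\<close>; this is why \<open>y n\<close> starts from
    \<open>f (Suc n)\<close>.\<close>
  define P where "P = (\<lambda>(n::nat) (i, f, S). i \<in> I \<and> f \<in> X \<and> (\<forall>t. 0 \<le> f t) \<and> N f \<le> 1
    \<and> e / 2 < x i f \<and> S \<in> X \<and> (\<forall>t. 0 \<le> S t))"
  define Q where "Q = (\<lambda>(n::nat) (i, f :: real \<Rightarrow> real, S) (i', f', S'). r i i' \<and> S' = (\<lambda>t. S t + f' t :: real)
    \<and> x i' S < e / (8 * 4 ^ n))"
  have "\<exists>w. \<forall>n. P n (w n) \<and> Q n (w n) (w (Suc n))"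
  proof (rule dependent_nat_choice)
    obtain i where "i \<in> I" using ne by blast
    from step[OF this] show "\<exists>w. P 0 w" unfolding P_def by auto
  next
    fix w n assume w: "P n w"
    obtain i f S where w_eq: "w = (i, f, S)" by (cases w)
    with w have i: "i \<in> I" and S: "S \<in> X" "\<forall>t. 0 \<le> S t" by (auto simp: P_def)
    obtain j where j: "j \<in> I" "x j S < e / (8 * 4 ^ n)"
      using dual_net_pointwise_null[OF net S(1), of "e / (8 * 4 ^ n)"] S(2) e by auto
    obtain k where k: "k \<in> I" "r i k" "r j k" using dir i j(1) by blast
    obtain l f' where l: "l \<in> I" "r k l" "f' \<in> X" "\<forall>t. 0 \<le> f' t" "N f' \<le> 1" "e / 2 < x l f'"
      using step[OF k(1)] by blast
    have "x l S \<le> x j S"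
      using dec[OF j(1) l(1) tr[OF j(1) k(1) l(1) k(3) l(2)]] S by (auto simp: dual_le_def ae_le_def)
    moreover have "r i l" by (rule tr[OF i k(1) l(1) k(2) l(2)])
    ultimately have "P (Suc n) (l, f', \<lambda>t. S t + f' t) \<and> Q n w (l, f', \<lambda>t. S t + f' t)"
      unfolding P_def Q_def w_eq using l S j(2) by (auto intro: add_mem)
    then show "\<exists>w'. P (Suc n) w' \<and> Q n w w'" by blast
  qed
  then obtain w where w: "\<And>n. P n (w n)" "\<And>n. Q n (w n) (w (Suc n))" by blast
  define i where "i n = fst (w n)" for n
  define f where "f n = fst (snd (w n))" for n
  define S where "S n = snd (snd (w n))" for n
  have i: "i n \<in> I" and f: "f n \<in> X" and f0: "0 \<le> f n t" and Nf: "N (f n) \<le> 1"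
    and xf: "e / 2 < x (i n) (f n)" and S: "S n \<in> X" and S0: "0 \<le> S n t" for n t
    using w(1)[of n] by (auto simp: P_def i_def f_def S_def split: prod.splits)
  have r_Suc: "r (i n) (i (Suc n))" and S_Suc: "S (Suc n) = (\<lambda>t. S n t + f (Suc n) t)"
    and xS: "x (i (Suc n)) (S n) < e / (8 * 4 ^ n)" for n
    using w(2)[of n] by (auto simp: Q_def i_def f_def S_def split: prod.splits)
  have r_0: "r (i 0) (i n)" for n
    by (induction n) (use refl tr i r_Suc in blast)+
  have f_le_S: "f (Suc m) t \<le> S n t" if "m < n" for m n t
    using that
  proof (induction n)
    case (Suc n)
    then show ?case
      using S_Suc[of n] f0[of "Suc n" t] S0[of n t] by (cases "m = n") (auto simp: add_increasing2)
  qed simp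
  obtain h where h: "h \<in> X" "AE t in unit_leb. \<forall>n. \<bar>f n t\<bar> \<le> 2 ^ n * h t"
    by (rule dominating_element[OF mc f Nf])
  have h0: "AE t in unit_leb. 0 \<le> h t"
    using h(2) by eventually_elim (metis abs_ge_zero order_trans mult_1 power_0)
  \<comment> \<open>The term \<open>4 ^ n * S n\<close> removes overlap with earlier functions, and
    \<open>(1/2) ^ n * h\<close> with later ones. If \<open>y m t > 0\<close>, then
    \<open>h t < 2 ^ m * f (Suc m) t\<close>; for \<open>m < n\<close> this gives \<open>f (Suc n) t
    \<le> 2 ^ (Suc n + m) * f (Suc m) t \<le> 4 ^ n * S n t\<close>, so
    \<open>y n t = 0\<close>.\<close>
  define y where "y n = (\<lambda>t. max 0 (f (Suc n) t - 4 ^ n * S n t - (1/2) ^ n * h t))" for n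
  have inner: "(\<lambda>t. f (Suc n) t - 4 ^ n * S n t - (1/2) ^ n * h t) \<in> X" for n
    by (intro diff_mem scale_mem f S h)
  have y: "y n \<in> X" for n unfolding y_def by (rule pos_part_mem(1)[OF inner])
  have y0: "0 \<le> y n t" for n t by (simp add: y_def)
  have Ny: "N (y n) \<le> 1" for n
  proof -
    have "N (y n) \<le> N (f (Suc n))"
    proof (rule solidI(2)[OF meas[OF y] f])
      show "AE t in unit_leb. \<bar>y n t\<bar> \<le> \<bar>f (Suc n) t\<bar>"
        using h0
      proof eventually_elim
        case (elim t)
        have "0 \<le> 4 ^ n * S n t" "0 \<le> (1/2) ^ n * h t" using S0 elim by auto
        then show ?case using f0[of "Suc n" t] by (auto simp: y_def)
      qed
    qed
    from this Nf show ?thesis by (rule order_trans)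
  qed
  have disj: "AE t in unit_leb. \<forall>m n. m < n \<longrightarrow> y m t = 0 \<or> y n t = 0"
    using h(2) h0
  proof (eventually_elim, intro allI impI)
    fix t and m n :: nat
    assume h: "\<forall>n. \<bar>f n t\<bar> \<le> 2 ^ n * h t" "0 \<le> h t" and mn: "m < n"
    show "y m t = 0 \<or> y n t = 0"
    proof (rule ccontr)
      assume no: "\<not> (y m t = 0 \<or> y n t = 0)"
      have S4: "0 \<le> 4 ^ m * S m t" "0 \<le> (1/2) ^ n * h t" using S0 h(2) by auto
      have "y m t > 0" "y n t > 0" using no y0[of m t] y0[of n t] by auto
      then have 1: "(1/2) ^ m * h t < f (Suc m) t" and 2: "4 ^ n * S n t < f (Suc n) t"
        using S4 by (auto simp: y_def less_max_iff_disj)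
      have "f (Suc n) t \<le> 2 ^ Suc n * h t" using h(1) by (meson abs_le_D1)
      also have "\<dots> \<le> 2 ^ Suc n * (2 ^ m * f (Suc m) t)"
        using 1 by (intro mult_left_mono) (auto simp: field_simps)
      also have "\<dots> = 2 ^ (Suc n + m) * f (Suc m) t" by (simp add: power_add)
      also have "\<dots> \<le> 2 ^ (2 * n) * f (Suc m) t"
        using mn f0 by (intro mult_right_mono power_increasing) auto
      also have "\<dots> = 4 ^ n * f (Suc m) t" by (simp add: power_mult)
      also have "\<dots> \<le> 4 ^ n * S n t" using f_le_S[OF mn] by simp
      also have "\<dots> < f (Suc n) t" by (rule 2)
      finally show False by simp
    qed
  qed
  obtain n0 where n0: "x (i 0) h * (1/2) ^ n < e / 8" if "n \<ge> n0" for n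
  proof -
    have "(\<lambda>n. x (i 0) h * (1/2) ^ n) \<longlonglongrightarrow> x (i 0) h * 0"
      by (intro tendsto_mult_left LIMSEQ_power_zero) simp
    then have "eventually (\<lambda>n. x (i 0) h * (1/2) ^ n < e / 8) sequentially"
      using e by (intro order_tendstoD) auto
    then show thesis using that by (auto simp: eventually_sequentially)
  qed
  have lower: "e / 4 \<le> x (i 0) (y n)" if n: "n \<ge> n0" for n
  proof -
    have le0: "x (i (Suc n)) p \<le> x (i 0) p" if "p \<in> X" "AE t in unit_leb. 0 \<le> p t" for p
      using dec[OF i i r_0] that by (auto simp: dual_le_def ae_le_def)
    have "4 ^ n * x (i (Suc n)) (S n) \<le> 4 ^ n * (e / (8 * 4 ^ n))"
      using xS[of n] by (intro mult_left_mono) auto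
    then have 1: "4 ^ n * x (i (Suc n)) (S n) \<le> e / 8" by simp
    have "(1/2) ^ n * x (i (Suc n)) h \<le> (1/2) ^ n * x (i 0) h"
      using le0[OF h(1) h0] by (intro mult_left_mono) auto
    then have 2: "(1/2) ^ n * x (i (Suc n)) h \<le> e / 8"
      using n0[OF n] unfolding mult.commute[of "(1/2) ^ n"] by linarith
    \<comment> \<open>Of the initial \<open>e / 2\<close>, each of the two subtracted terms takes at
      most \<open>e / 8\<close>.\<close>
    have "e / 4 \<le> x (i (Suc n)) (f (Suc n)) - 4 ^ n * x (i (Suc n)) (S n) - (1/2) ^ n * x (i (Suc n)) h"
      using xf[of "Suc n"] 1 2 by linarith
    also have "\<dots> = x (i (Suc n)) (\<lambda>t. f (Suc n) t - 4 ^ n * S n t - (1/2) ^ n * h t)"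
      by (simp only: dual_diff[OF x[OF i]] dual_scale[OF x[OF i]] diff_mem scale_mem f S h(1))
    also have "\<dots> \<le> x (i (Suc n)) (y n)"
      by (rule dual_mono[OF x[OF i] pos[OF i] inner y]) (simp add: y_def)
    \<comment> \<open>Returning to the index \<open>i 0\<close> provides one fixed positive
      functional for all \<open>n\<close>.\<close>
    also have "\<dots> \<le> x (i 0) (y n)" by (rule le0[OF y]) (simp add: y0)
    finally show ?thesis .
  qed
  show False
  proof (rule oBSP_disjoint[OF oBSP x[OF i] pos[OF i]])
    show "y (n + n0) \<in> X" "N (y (n + n0)) \<le> 1" "0 \<le> y (n + n0) t"
      "e / 4 \<le> x (i 0) (y (n + n0))" for n t
      using y Ny y0 lower by auto
    show "AE t in unit_leb. \<forall>m n. m < n \<longrightarrow> y (m + n0) t = 0 \<or> y (n + n0) t = 0"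
      using disj by eventually_elim simp
    show "0 < e / 4" using e by simp
  qed
qed

end


subsection \<open>Weakly convergent subsequences by minimising an exponential functional\<close>

text \<open>
  Dyadic convex combinations of the tail of \<open>f\<close> suffice; \<open>convex hull\<close> is not available, since
  \<open>real \<Rightarrow> real\<close> is not an instance of \<open>real_vector\<close>.
\<close>

inductive_set midpoints :: "(nat \<Rightarrow> real \<Rightarrow> real) \<Rightarrow> nat \<Rightarrow> (real \<Rightarrow> real) set"
  for f :: "nat \<Rightarrow> real \<Rightarrow> real" and n :: nat where
  base: "n \<le> k \<Longrightarrow> f k \<in> midpoints f n"
| mid: "a \<in> midpoints f n \<Longrightarrow> b \<in> midpoints f n \<Longrightarrow> (\<lambda>t. (a t + b t) / 2) \<in> midpoints f n"

lemma midpoints_antimono: "m \<le> n \<Longrightarrow> midpoints f n \<subseteq> midpoints f m"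
proof
  fix y assume "m \<le> n" "y \<in> midpoints f n"
  from this(2,1) show "y \<in> midpoints f m" by induction (auto intro: midpoints.intros)
qed

lemma midpoints_subseq:
  assumes "strict_mono r"
  shows "midpoints (f \<circ> r) n \<subseteq> midpoints f n"
proof
  fix y assume "y \<in> midpoints (f \<circ> r) n"
  then show "y \<in> midpoints f n"
  proof induction
    case (base k)
    then show ?case using seq_suble[OF assms, of k] by (auto intro: midpoints.base)
  qed (rule midpoints.mid)
qed

lemma midpoints_shift: "midpoints f (n + k) \<subseteq> midpoints (f \<circ> (+) k) n"
proof
  fix y assume "y \<in> midpoints f (n + k)"
  then show "y \<in> midpoints (f \<circ> (+) k) n"
  proof induction
    case (base j)
    then show ?case using midpoints.base[of n "j - k" "f \<circ> (+) k"] by (auto simp: comp_def)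
  qed (rule midpoints.mid)
qed

section \<open>Exponential means and their asymptotic infima\<close>

text \<open>The exponential makes the functional finite, with values between \<open>0\<close> and
  \<open>1\<close>, on all nonnegative measurable functions; elements of \<open>X\<close> may fail
  to be integrable.\<close>

definition exp_mean :: "(real \<Rightarrow> real) \<Rightarrow> real" where
  "exp_mean y = (\<integral>t. exp (- y t) \<partial>unit_leb)"

definition tail_inf :: "(nat \<Rightarrow> real \<Rightarrow> real) \<Rightarrow> nat \<Rightarrow> real" where
  "tail_inf f n = (INF y\<in>midpoints f n. exp_mean y)"

text \<open>The infima over shrinking tails increase, so this supremum is their limit: the
  asymptotic infimum of \<open>exp_mean\<close> over midpoints of late terms.\<close>

definition tail_lim :: "(nat \<Rightarrow> real \<Rightarrow> real) \<Rightarrow> real" where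
  "tail_lim f = (SUP n. tail_inf f n)"

definition nonneg_meas :: "(real \<Rightarrow> real) \<Rightarrow> bool" where
  "nonneg_meas y \<longleftrightarrow> y \<in> borel_measurable unit_leb \<and> (\<forall>t. 0 \<le> y t)"

lemma nonneg_measD:
  assumes "nonneg_meas y"
  shows "y \<in> borel_measurable unit_leb" "0 \<le> y t"
  using assms by (auto simp: nonneg_meas_def)

lemma midpoints_nonneg_meas:
  assumes f: "\<And>n. nonneg_meas (f n)" and y: "y \<in> midpoints f n"
  shows "nonneg_meas y"
  using y by induction (use f in \<open>auto simp: nonneg_meas_def\<close>)

lemma integral_unit_leb_le:
  fixes u :: "real \<Rightarrow> real"
  assumes "\<And>t. u t \<le> B" "u \<in> borel_measurable unit_leb" "\<And>t. 0 \<le> u t"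
  shows "(\<integral>t. u t \<partial>unit_leb) \<le> B"
proof -
  have "integrable unit_leb u"
    using assms by (intro unit_leb.integrable_const_bound[of _ B]) auto
  then have "(\<integral>t. u t \<partial>unit_leb) \<le> (\<integral>t. B \<partial>unit_leb)"
    using assms by (intro integral_mono) auto
  then show ?thesis using measure_unit_leb by simp
qed

lemma exp_integrable:
  assumes "nonneg_meas y" "0 \<le> c"
  shows "integrable unit_leb (\<lambda>t. exp (- (c * y t)))"
  using assms by (intro unit_leb.integrable_const_bound[of _ 1]) (auto simp: nonneg_meas_def)

lemma exp_mean_bounds:
  assumes "nonneg_meas y"
  shows "0 \<le> exp_mean y" "exp_mean y \<le> 1"
  unfolding exp_mean_def
  using assms by (auto intro!: integral_unit_leb_le integral_nonneg simp: nonneg_meas_def)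

lemma exp_half_integrable:
  assumes "nonneg_meas a"
  shows "integrable unit_leb (\<lambda>t. exp (- a t / 2))"
  using exp_integrable[OF assms, of "1/2"] by (simp add: field_simps)

text \<open>
  The quantitative strict convexity of \<open>exp_mean\<close>, playing the role of the parallelogram law.
\<close>

lemma exp_mean_midpoint:
  assumes a: "nonneg_meas a" and b: "nonneg_meas b"
  shows "integrable unit_leb (\<lambda>t. (exp (- a t / 2) - exp (- b t / 2))\<^sup>2)"
    and "(\<integral>t. (exp (- a t / 2) - exp (- b t / 2))\<^sup>2 \<partial>unit_leb)
      = exp_mean a + exp_mean b - 2 * exp_mean (\<lambda>t. (a t + b t) / 2)"
proof -
  have eq: "(exp (- a t / 2) - exp (- b t / 2))\<^sup>2
      = exp (- a t) + exp (- b t) - 2 * exp (- ((a t + b t) / 2))" for t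
  proof -
    have "exp (- a t) = (exp (- a t / 2))\<^sup>2" "exp (- b t) = (exp (- b t / 2))\<^sup>2"
      using exp_double[of "- a t / 2"] exp_double[of "- b t / 2"] by simp_all
    moreover have "exp (- ((a t + b t) / 2)) = exp (- a t / 2) * exp (- b t / 2)"
      by (simp add: add_divide_distrib flip: exp_add)
    ultimately show ?thesis by (simp only: power2_diff)
  qed
  have mid: "nonneg_meas (\<lambda>t. (a t + b t) / 2)"
    using a b by (auto simp: nonneg_meas_def)
  have int: "integrable unit_leb (\<lambda>t. exp (- a t))" "integrable unit_leb (\<lambda>t. exp (- b t))"
    "integrable unit_leb (\<lambda>t. exp (- ((a t + b t) / 2)))"
    using exp_integrable[OF a, of 1] exp_integrable[OF b, of 1] exp_integrable[OF mid, of 1] by auto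
  show "integrable unit_leb (\<lambda>t. (exp (- a t / 2) - exp (- b t / 2))\<^sup>2)"
    unfolding eq using int by (intro Bochner_Integration.integrable_diff Bochner_Integration.integrable_add) auto
  show "(\<integral>t. (exp (- a t / 2) - exp (- b t / 2))\<^sup>2 \<partial>unit_leb)
      = exp_mean a + exp_mean b - 2 * exp_mean (\<lambda>t. (a t + b t) / 2)"
    unfolding eq exp_mean_def using int by simp
qed

lemma tail_inf_le:
  assumes f: "\<And>n. nonneg_meas (f n)" and y: "y \<in> midpoints f n"
  shows "tail_inf f n \<le> exp_mean y"
  unfolding tail_inf_def
  using exp_mean_bounds(1)[OF midpoints_nonneg_meas[OF f]]
  by (intro cINF_lower[OF _ y] bdd_belowI[of _ 0]) auto

lemma tail_inf_greatest:
  assumes "\<And>y. y \<in> midpoints f n \<Longrightarrow> c \<le> exp_mean y"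
  shows "c \<le> tail_inf f n"
  unfolding tail_inf_def using assms midpoints.base[of n n f] by (intro cINF_greatest) auto

lemma tail_inf_incseq:
  assumes f: "\<And>n. nonneg_meas (f n)"
  shows "incseq (tail_inf f)"
  using midpoints_antimono by (intro monoI tail_inf_greatest tail_inf_le[OF f]) blast

lemma tail_inf_le_1:
  assumes f: "\<And>n. nonneg_meas (f n)"
  shows "tail_inf f n \<le> 1"
  using tail_inf_le[of f, OF f midpoints.base[of n n f]] exp_mean_bounds(2)[OF f[of n]] by simp

lemma tail_inf_bdd:
  assumes f: "\<And>n. nonneg_meas (f n)"
  shows "bdd_above (range (tail_inf f))"
  using tail_inf_le_1[OF f] by (intro bdd_aboveI[of _ 1]) auto

lemma tail_inf_le_tail_lim:
  assumes f: "\<And>n. nonneg_meas (f n)"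
  shows "tail_inf f n \<le> tail_lim f"
  unfolding tail_lim_def by (intro cSUP_upper tail_inf_bdd[OF f]) simp

lemma tail_lim_least: "(\<And>n. tail_inf f n \<le> c) \<Longrightarrow> tail_lim f \<le> c"
  unfolding tail_lim_def by (intro cSUP_least) auto

lemma tail_inf_tendsto:
  assumes f: "\<And>n. nonneg_meas (f n)"
  shows "tail_inf f \<longlonglongrightarrow> tail_lim f"
  unfolding tail_lim_def by (intro LIMSEQ_incseq_SUP tail_inf_bdd tail_inf_incseq f)

lemma tail_inf_subseq:
  assumes f: "\<And>n. nonneg_meas (f n)" and r: "strict_mono r"
  shows "tail_inf f n \<le> tail_inf (f \<circ> r) n"
  using midpoints_subseq[OF r] by (intro tail_inf_greatest tail_inf_le[OF f]) blast

lemma tail_lim_subseq: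
  assumes f: "\<And>n. nonneg_meas (f n)" and r: "strict_mono r"
  shows "tail_lim f \<le> tail_lim (f \<circ> r)"
proof (rule tail_lim_least)
  fix n
  have "tail_inf f n \<le> tail_inf (f \<circ> r) n" by (rule tail_inf_subseq[OF f r])
  also have "\<dots> \<le> tail_lim (f \<circ> r)" by (rule tail_inf_le_tail_lim) (simp add: f)
  finally show "tail_inf f n \<le> tail_lim (f \<circ> r)" .
qed

text \<open>Midpoints of the tail of \<open>f\<close> from \<open>n + k\<close> on are midpoints of
  the shifted sequence from \<open>n\<close> on. Together with \<open>tail_lim_subseq\<close>,
  finitely many initial terms do not affect \<open>tail_lim\<close>, as the diagonal argument
  requires.\<close>

lemma tail_lim_shift:
  assumes f: "\<And>n. nonneg_meas (f n)"
  shows "tail_lim (f \<circ> (+) k) \<le> tail_lim f"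
proof (rule tail_lim_least)
  fix n
  have "tail_inf (f \<circ> (+) k) n \<le> tail_inf f (n + k)"
    using midpoints_shift by (intro tail_inf_greatest tail_inf_le) (auto simp: f)
  also have "\<dots> \<le> tail_lim f" by (rule tail_inf_le_tail_lim[OF f])
  finally show "tail_inf (f \<circ> (+) k) n \<le> tail_lim f" .
qed

lemma tail_lim_le_1:
  assumes f: "\<And>n. nonneg_meas (f n)"
  shows "tail_lim f \<le> 1"
  using tail_inf_le_1[OF f] by (rule tail_lim_least)

text \<open>
  Passing to a subsequence only increases \<open>tail_lim\<close>. Once it cannot be increased any further,
  the minimising midpoints of all subsequences have the same limit.
\<close>

lemma maximal_subsequence:
  fixes f :: "nat \<Rightarrow> real \<Rightarrow> real"
  assumes f: "\<And>n. nonneg_meas (f n)"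
  obtains r where "strict_mono r"
    "\<forall>r'. strict_mono r' \<longrightarrow> tail_lim (f \<circ> r \<circ> r') \<le> tail_lim (f \<circ> r)"
proof -
  \<comment> \<open>\<open>P n s\<close> says that no subsequence of \<open>f \<circ> s\<close>
    improves \<open>tail_lim\<close> by more than \<open>1 / Suc n\<close>. The diagonal sequence
    satisfies each \<open>P n\<close> after finitely many terms are dropped.\<close>
  define P where "P n s \<longleftrightarrow> (\<forall>r'. strict_mono r' \<longrightarrow>
    tail_lim (f \<circ> s \<circ> r') \<le> tail_lim (f \<circ> s) + 1 / real (Suc n))" for n :: nat and s :: "nat \<Rightarrow> nat"
  have fs: "nonneg_meas ((f \<circ> s) n)" for s :: "nat \<Rightarrow> nat" and n by (simp add: f)
  interpret subseqs P
  proof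
    fix n :: nat and s :: "nat \<Rightarrow> nat" assume s: "strict_mono s"
    define R where "R = {r' :: nat \<Rightarrow> nat. strict_mono r'}"
    have R: "R \<noteq> {}" by (auto simp: R_def intro!: exI[of _ id] strict_monoI)
    have bdd: "bdd_above ((\<lambda>r'. tail_lim (f \<circ> s \<circ> r')) ` R)"
      using tail_lim_le_1 f by (intro bdd_aboveI[of _ 1]) auto
    have "(SUP r'\<in>R. tail_lim (f \<circ> s \<circ> r')) - 1 / real (Suc n) < (SUP r'\<in>R. tail_lim (f \<circ> s \<circ> r'))"
      by simp
    then have "\<exists>r\<in>R. (SUP r'\<in>R. tail_lim (f \<circ> s \<circ> r')) - 1 / real (Suc n) < tail_lim (f \<circ> s \<circ> r)"
      by (rule less_cSUP_iff[OF R bdd, THEN iffD1])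
    then obtain r where r: "strict_mono r"
      "(SUP r'\<in>R. tail_lim (f \<circ> s \<circ> r')) - 1 / real (Suc n) < tail_lim (f \<circ> s \<circ> r)"
      unfolding R_def by blast
    have "P n (s \<circ> r)"
      unfolding P_def
    proof (intro allI impI)
      fix r' :: "nat \<Rightarrow> nat" assume r': "strict_mono r'"
      have "tail_lim (f \<circ> s \<circ> (r \<circ> r')) \<le> (SUP r'\<in>R. tail_lim (f \<circ> s \<circ> r'))"
        by (rule cSUP_upper[OF _ bdd]) (simp add: R_def strict_mono_o r r')
      with r(2) show "tail_lim (f \<circ> (s \<circ> r) \<circ> r') \<le> tail_lim (f \<circ> (s \<circ> r)) + 1 / real (Suc n)"
        by (simp add: o_assoc)
    qed
    with r(1) show "\<exists>r'. strict_mono r' \<and> P n (s \<circ> r')" by blast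
  qed
  \<comment> \<open>Near-maximality survives passing to a subsequence, because
    \<open>tail_lim\<close> can only grow.\<close>
  have stable: "P n (s \<circ> r)" if "strict_mono r" "P n s" for r s n
    unfolding P_def
  proof (intro allI impI)
    fix r' :: "nat \<Rightarrow> nat" assume r': "strict_mono r'"
    have "tail_lim (f \<circ> s \<circ> (r \<circ> r')) \<le> tail_lim (f \<circ> s) + 1 / real (Suc n)"
      using that r' by (auto simp: P_def strict_mono_o)
    also have "tail_lim (f \<circ> s) \<le> tail_lim (f \<circ> s \<circ> r)" by (rule tail_lim_subseq[OF fs that(1)])
    finally show "tail_lim (f \<circ> (s \<circ> r) \<circ> r') \<le> tail_lim (f \<circ> (s \<circ> r)) + 1 / real (Suc n)"
      by (simp add: o_assoc)
  qed
  show thesis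
  proof (rule that[OF subseq_diagseq], intro allI impI)
    fix r' :: "nat \<Rightarrow> nat" assume r': "strict_mono r'"
    define g where "g = f \<circ> diagseq"
    have g: "nonneg_meas (g n)" for n by (simp add: g_def f)
    have "tail_lim (g \<circ> r') \<le> tail_lim g + 1 / real (Suc n)" for n
    proof -
      define k where "k = Suc n"
      \<comment> \<open>This rewrites \<open>r' \<circ> (+) k\<close> as
        \<open>(+) k \<circ> q\<close>, a subsequence of the shifted diagonal to which
        \<open>P n\<close> applies; \<open>k = Suc n\<close> is the shift at which the diagonal
        sequence satisfies it.\<close>
      define q where "q j = r' (k + j) - k" for j
      have ge: "k \<le> r' (k + j)" for j using seq_suble[OF r', of "k + j"] by simp
      have q: "strict_mono q"
        unfolding strict_mono_Suc_iff q_def using ge strict_monoD[OF r']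
        by (metis add_Suc_right diff_less_mono lessI)
      have "r' \<circ> (+) k = (+) k \<circ> q" using ge by (auto simp: q_def)
      then have eq: "g \<circ> r' \<circ> (+) k = f \<circ> (diagseq \<circ> (+) k) \<circ> q"
        by (auto simp: g_def fun_eq_iff)
      have k: "strict_mono ((+) k)" by (simp add: strict_mono_def)
      have "tail_lim (g \<circ> r') \<le> tail_lim (g \<circ> r' \<circ> (+) k)"
        by (rule tail_lim_subseq[OF _ k]) (simp add: g)
      also have "\<dots> \<le> tail_lim (f \<circ> (diagseq \<circ> (+) k)) + 1 / real (Suc n)"
        unfolding eq using diagseq_holds[OF stable, of n] q by (simp add: P_def k_def)
      also have "f \<circ> (diagseq \<circ> (+) k) = g \<circ> (+) k" by (simp add: g_def o_assoc)
      also have "tail_lim (g \<circ> (+) k) + 1 / real (Suc n) \<le> tail_lim g + 1 / real (Suc n)"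
        by (intro add_right_mono tail_lim_shift[OF g])
      finally show ?thesis .
    qed
    note le = this
    have "tail_lim (g \<circ> r') \<le> tail_lim g"
    proof (rule LIMSEQ_le_const)
      show "(\<lambda>n. tail_lim g + 1 / real (Suc n)) \<longlonglongrightarrow> tail_lim g"
        using tendsto_add[OF tendsto_const LIMSEQ_inverse_real_of_nat, of "tail_lim g"]
        by (simp add: inverse_eq_divide)
      show "\<exists>N. \<forall>n\<ge>N. tail_lim (g \<circ> r') \<le> tail_lim g + 1 / real (Suc n)" using le by blast
    qed
    then show "tail_lim (f \<circ> diagseq \<circ> r') \<le> tail_lim (f \<circ> diagseq)" by (simp add: g_def)
  qed
qed

section \<open>Convergence and uniqueness of minimising midpoints\<close>

text \<open>Integrate \<open>|u| \<le> e / 2 + u^2 / (2 * e)\<close>, which comes from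
  \<open>(|u| - e)^2 \<ge> 0\<close>, over a space of measure one.\<close>

lemma integral_abs_less_of_square:
  fixes u :: "real \<Rightarrow> real"
  assumes u: "integrable unit_leb u" "integrable unit_leb (\<lambda>t. (u t)\<^sup>2)"
    and e: "e > 0" and less: "(\<integral>t. (u t)\<^sup>2 \<partial>unit_leb) < e\<^sup>2"
  shows "(\<integral>t. \<bar>u t\<bar> \<partial>unit_leb) < e"
proof -
  have "(\<integral>t. \<bar>u t\<bar> \<partial>unit_leb) \<le> (\<integral>t. e / 2 + (u t)\<^sup>2 / (2 * e) \<partial>unit_leb)"
  proof (rule integral_mono)
    show "integrable unit_leb (\<lambda>t. e / 2 + (u t)\<^sup>2 / (2 * e))" using u by simp
    fix t
    have "0 \<le> (\<bar>u t\<bar> - e)\<^sup>2" by simp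
    then have "2 * e * \<bar>u t\<bar> \<le> e\<^sup>2 + (u t)\<^sup>2" by (simp add: power2_diff algebra_simps)
    then show "\<bar>u t\<bar> \<le> e / 2 + (u t)\<^sup>2 / (2 * e)" using e by (simp add: field_simps power2_eq_square)
  qed (use u in simp)
  also have "\<dots> = e / 2 + (\<integral>t. (u t)\<^sup>2 \<partial>unit_leb) / (2 * e)"
    using u measure_unit_leb by simp
  also have "\<dots> < e / 2 + e\<^sup>2 / (2 * e)"
    using less e by (intro add_strict_left_mono divide_strict_right_mono) auto
  also have "\<dots> = e" using e by (simp add: power2_eq_square)
  finally show ?thesis .
qed

context banach_function_space
begin

lemma midpoints_mem:
  assumes f: "\<And>n. f n \<in> X" and C: "\<And>n. N (f n) \<le> C" and y: "y \<in> midpoints f n"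
  shows "y \<in> X \<and> N y \<le> C"
  using y
proof induction
  case (base k)
  then show ?case using f C by simp
next
  case (mid a b)
  have "N (\<lambda>t. (1/2) * (a t + b t)) = \<bar>1/2\<bar> * N (\<lambda>t. a t + b t)"
    using mid by (intro norm_scale add_mem) auto
  moreover have "N (\<lambda>t. a t + b t) \<le> N a + N b" using mid by (intro norm_triangle) auto
  moreover have "(\<lambda>t. (1/2) * (a t + b t)) \<in> X" using mid by (intro scale_mem add_mem) auto
  ultimately show ?case using mid by simp
qed

text \<open>Averages of almost minimising midpoints are again midpoints, so strict convexity makes
  the functions \<open>exp (- v k / 2)\<close> Cauchy in mean, and a subsequence converges a.e. The
  norm bound keeps the limit away from \<open>0\<close>, so taking logarithms gives convergence of
  the midpoints themselves.\<close>

lemma minimising_midpoints_converge: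
  fixes f :: "nat \<Rightarrow> real \<Rightarrow> real"
  assumes mc: "monotonically_complete X N" and f: "\<And>n. f n \<in> X" and C: "\<And>n. N (f n) \<le> C"
    and f0: "\<And>n t. 0 \<le> f n t"
  obtains w y where "\<forall>k. w k \<in> midpoints f k" "y \<in> X" "AE t in unit_leb. (\<lambda>k. w k t) \<longlonglongrightarrow> y t"
    "(\<lambda>k. exp_mean (w k)) \<longlonglongrightarrow> tail_lim f"
proof -
  have fn: "nonneg_meas (f n)" for n using meas[OF f] f0 by (simp add: nonneg_meas_def)
  have "\<exists>y\<in>midpoints f k. exp_mean y < tail_inf f k + 1 / real (Suc k)" for k
  proof (rule ccontr)
    assume "\<not> ?thesis"
    then have "tail_inf f k + 1 / real (Suc k) \<le> tail_inf f k"
      by (intro tail_inf_greatest) auto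
    then show False by simp
  qed
  then obtain v where v: "\<And>k. v k \<in> midpoints f k"
    and v_less: "\<And>k. exp_mean (v k) < tail_inf f k + 1 / real (Suc k)" by metis
  have v_lim: "(\<lambda>k. exp_mean (v k)) \<longlonglongrightarrow> tail_lim f"
  proof (rule tendsto_sandwich)
    show "(\<lambda>k. tail_inf f k) \<longlonglongrightarrow> tail_lim f" by (rule tail_inf_tendsto[OF fn])
    show "(\<lambda>k. tail_inf f k + 1 / real (Suc k)) \<longlonglongrightarrow> tail_lim f"
      using tendsto_add[OF tail_inf_tendsto[OF fn] LIMSEQ_inverse_real_of_nat]
      by (simp add: inverse_eq_divide)
    show "eventually (\<lambda>k. tail_inf f k \<le> exp_mean (v k)) sequentially"
      using tail_inf_le[OF fn v] by simp
    show "eventually (\<lambda>k. exp_mean (v k) \<le> tail_inf f k + 1 / real (Suc k)) sequentially"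
      using v_less by (simp add: less_imp_le)
  qed
  have vn: "nonneg_meas (v k)" for k by (rule midpoints_nonneg_meas[OF fn v])
  define u where "u k = (\<lambda>t. exp (- v k t / 2))" for k
  have u: "integrable unit_leb (u k)" for k unfolding u_def by (rule exp_half_integrable[OF vn])
  have u2: "integrable unit_leb (\<lambda>t. (u j t - u k t)\<^sup>2)"
    "(\<integral>t. (u j t - u k t)\<^sup>2 \<partial>unit_leb)
      = exp_mean (v j) + exp_mean (v k) - 2 * exp_mean (\<lambda>t. (v j t + v k t) / 2)" for j k
    unfolding u_def by (rule exp_mean_midpoint[OF vn vn])+
  have "\<exists>M. \<forall>i\<ge>M. \<forall>j\<ge>M. (LINT x|unit_leb. norm (u i x - u j x)) < e" if e: "e > 0" for e
  proof -
    \<comment> \<open>Two errors of \<open>e^2 / 4\<close> from the means and twice that from the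
      infimum add up to the \<open>e^2\<close> allowed for the integral of the square.\<close>
    have "eventually (\<lambda>k. exp_mean (v k) < tail_lim f + e\<^sup>2 / 4) sequentially"
      using order_tendstoD(2)[OF v_lim] e by simp
    moreover have "eventually (\<lambda>k. tail_lim f - e\<^sup>2 / 4 < tail_inf f k) sequentially"
      using order_tendstoD(1)[OF tail_inf_tendsto[OF fn]] e by simp
    ultimately have "eventually (\<lambda>k. exp_mean (v k) < tail_lim f + e\<^sup>2 / 4
        \<and> tail_lim f - e\<^sup>2 / 4 < tail_inf f k) sequentially"
      by (rule eventually_conj)
    then obtain M where M: "\<And>k. k \<ge> M \<Longrightarrow> exp_mean (v k) < tail_lim f + e\<^sup>2 / 4"
      "tail_lim f - e\<^sup>2 / 4 < tail_inf f M"
      unfolding eventually_sequentially by blast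
    show ?thesis
    proof (intro exI allI impI)
      fix i j assume ij: "M \<le> i" "M \<le> j"
      have "(\<lambda>t. (v i t + v j t) / 2) \<in> midpoints f M"
        using v[of i] v[of j] midpoints_antimono[OF ij(1)] midpoints_antimono[OF ij(2)]
        by (intro midpoints.mid) blast+
      then have "tail_inf f M \<le> exp_mean (\<lambda>t. (v i t + v j t) / 2)" by (rule tail_inf_le[OF fn])
      then have "(\<integral>t. (u i t - u j t)\<^sup>2 \<partial>unit_leb) < e\<^sup>2"
        unfolding u2 using M(1)[OF ij(1)] M(1)[OF ij(2)] M(2) by linarith
      then have "(\<integral>t. \<bar>u i t - u j t\<bar> \<partial>unit_leb) < e"
        using u u2(1) e by (intro integral_abs_less_of_square) auto
      then show "(LINT x|unit_leb. norm (u i x - u j x)) < e" by simp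
    qed
  qed
  with u obtain r where r: "strict_mono r" and cauchy: "AE t in unit_leb. Cauchy (\<lambda>i. u (r i) t)"
    by (rule cauchy_L1_AE_cauchy_subseq)
  define w where "w k = v (r k)" for k
  have w: "w k \<in> midpoints f k" for k
    using v[of "r k"] midpoints_antimono[OF seq_suble[OF r, of k]] by (auto simp: w_def)
  have wX: "w k \<in> X" and wC: "N (w k) \<le> C" for k using midpoints_mem[OF f C w] by auto
  have w0: "0 \<le> w k t" for k t using vn by (simp add: w_def nonneg_meas_def)
  obtain h where h: "h \<in> X" "AE t in unit_leb. \<forall>c k. (\<forall>j\<ge>k. c \<le> w j t) \<longrightarrow> c \<le> h t"
    by (rule liminf_dominated[OF mc wX wC]) (simp add: w0)
  have conv: "AE t in unit_leb. convergent (\<lambda>k. w k t)"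
    using cauchy h(2)
  proof eventually_elim
    case (elim t)
    then obtain c where c: "(\<lambda>k. u (r k) t) \<longlonglongrightarrow> c"
      by (auto simp: Cauchy_convergent_iff convergent_def)
    have "c \<ge> 0" by (rule LIMSEQ_le_const[OF c]) (auto simp: u_def)
    \<comment> \<open>A zero limit would mean that \<open>w k t\<close> tends to infinity, against
      the bound \<open>h t\<close> on its lower limit.\<close>
    moreover have "c \<noteq> 0"
    proof
      assume "c = 0"
      with c have "eventually (\<lambda>k. u (r k) t < exp (- (h t + 1) / 2)) sequentially"
        by (intro order_tendstoD) auto
      then obtain k where "\<forall>j\<ge>k. h t + 1 \<le> w j t"
        by (force simp: eventually_sequentially u_def w_def)
      with elim(2) have "h t + 1 \<le> h t" by blast
      then show False by simp
    qed
    ultimately have "(\<lambda>k. - 2 * ln (u (r k) t)) \<longlonglongrightarrow> - 2 * ln c"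
      using c by (intro tendsto_intros) auto
    then show ?case by (auto simp: u_def w_def convergent_def)
  qed
  define y where "y t = lim (\<lambda>k. w k t)" for t
  have lim: "AE t in unit_leb. (\<lambda>k. w k t) \<longlonglongrightarrow> y t"
    using conv by eventually_elim (simp add: y_def convergent_LIMSEQ_iff)
  have ym: "y \<in> borel_measurable unit_leb"
    unfolding y_def[abs_def] using meas[OF wX] by measurable
  show thesis
  proof (rule that[OF _ _ lim])
    show "\<forall>k. w k \<in> midpoints f k" using w by blast
    show "y \<in> X" by (rule AE_limit_mem[OF mc wX wC _ ym lim]) (simp add: w0)
    show "(\<lambda>k. exp_mean (w k)) \<longlonglongrightarrow> tail_lim f"
      using LIMSEQ_subseq_LIMSEQ[OF v_lim r] by (simp add: w_def comp_def)
  qed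
qed

end

text \<open>The average of \<open>w1 k\<close> and \<open>w2 k\<close> is again a midpoint of the
  tail, so by \<open>exp_mean_midpoint\<close> the integral of the squared difference of their half
  exponentials tends to \<open>0\<close>. Dominated convergence passes this to the limits.\<close>

lemma minimisers_unique:
  fixes f :: "nat \<Rightarrow> real \<Rightarrow> real"
  assumes f: "\<And>n. nonneg_meas (f n)"
    and w1: "\<And>k. w1 k \<in> midpoints f k" "(\<lambda>k. exp_mean (w1 k)) \<longlonglongrightarrow> tail_lim f"
    and w2: "\<And>k. w2 k \<in> midpoints f k" "(\<lambda>k. exp_mean (w2 k)) \<longlonglongrightarrow> tail_lim f"
    and y1: "AE t in unit_leb. (\<lambda>k. w1 k t) \<longlonglongrightarrow> y1 t" "y1 \<in> borel_measurable unit_leb"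
    and y2: "AE t in unit_leb. (\<lambda>k. w2 k t) \<longlonglongrightarrow> y2 t" "y2 \<in> borel_measurable unit_leb"
  shows "AE t in unit_leb. y1 t = y2 t"
proof -
  define d where "d k t = (exp (- w1 k t / 2) - exp (- w2 k t / 2))\<^sup>2" for k t
  define D where "D t = (exp (- y1 t / 2) - exp (- y2 t / 2))\<^sup>2" for t
  have n1: "nonneg_meas (w1 k)" and n2: "nonneg_meas (w2 k)" for k
    by (rule midpoints_nonneg_meas[OF f w1(1)], rule midpoints_nonneg_meas[OF f w2(1)])
  note [measurable] = nonneg_measD(1)[OF n1] nonneg_measD(1)[OF n2] y1(2) y2(2)
  have d_lim: "AE t in unit_leb. (\<lambda>k. d k t) \<longlonglongrightarrow> D t"
    using y1(1) y2(1) unfolding d_def D_def by eventually_elim (rule tendsto_power tendsto_diff tendsto_exp tendsto_divide tendsto_minus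
        tendsto_const zero_neq_numeral[symmetric] | assumption)+
  have d_le: "norm (d k t) \<le> 1" for k t
  proof -
    have "\<bar>exp (- w1 k t / 2) - exp (- w2 k t / 2)\<bar> \<le> 1"
    proof -
      have "exp (- w1 k t / 2) \<le> 1" "exp (- w2 k t / 2) \<le> 1"
        using nonneg_measD(2)[OF n1, of k t] nonneg_measD(2)[OF n2, of k t] by auto
      moreover have "0 < exp (- w1 k t / 2)" "0 < exp (- w2 k t / 2)" by auto
      ultimately show ?thesis by linarith
    qed
    then show ?thesis by (simp add: d_def abs_square_le_1)
  qed
  have dm: "d k \<in> borel_measurable unit_leb" "D \<in> borel_measurable unit_leb" for k
    unfolding d_def[abs_def] D_def[abs_def] by measurable
  have lim: "(\<lambda>k. \<integral>t. d k t \<partial>unit_leb) \<longlonglongrightarrow> (\<integral>t. D t \<partial>unit_leb)"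
    and D: "integrable unit_leb D"
    using integral_dominated_convergence[OF dm(2,1) _ d_lim, of "\<lambda>_. 1"]
      integrable_dominated_convergence[OF dm(2,1) _ d_lim, of "\<lambda>_. 1"] d_le by auto
  have d_bd: "(\<integral>t. d k t \<partial>unit_leb) \<le> exp_mean (w1 k) + exp_mean (w2 k) - 2 * tail_inf f k" for k
    using tail_inf_le[OF f midpoints.mid[OF w1(1) w2(1)]]
    unfolding d_def exp_mean_midpoint(2)[OF n1 n2] by simp
  have "(\<lambda>k. exp_mean (w1 k) + exp_mean (w2 k) - 2 * tail_inf f k)
      \<longlonglongrightarrow> tail_lim f + tail_lim f - 2 * tail_lim f"
    by (intro tendsto_intros w1 w2 tail_inf_tendsto[OF f])
  then have "(\<integral>t. D t \<partial>unit_leb) \<le> tail_lim f + tail_lim f - 2 * tail_lim f"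
    by (rule LIMSEQ_le[OF lim]) (use d_bd in blast)
  moreover have nn: "AE t in unit_leb. 0 \<le> D t" by (simp add: D_def)
  ultimately have "(\<integral>t. D t \<partial>unit_leb) = 0" using integral_nonneg_AE[OF nn] by simp
  then have "AE t in unit_leb. D t = 0" using integral_nonneg_eq_0_iff_AE[OF D nn] by blast
  then show ?thesis by eventually_elim (simp add: D_def)
qed

lemma abs_midpoint_less:
  fixes x y l c :: real
  assumes "\<bar>x - l\<bar> < c" "\<bar>y - l\<bar> < c"
  shows "\<bar>(x + y) / 2 - l\<bar> < c"
  using assms unfolding abs_diff_less_iff by auto

text \<open>Terms that stay away from \<open>c\<close> would, by Bolzano-Weierstrass, have a
  convergent subsequence with a limit other than \<open>c\<close>.\<close>

lemma tendsto_of_convergent_subseqs: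
  fixes a :: "nat \<Rightarrow> real"
  assumes bdd: "bounded (range a)"
    and sub: "\<And>q l. strict_mono q \<Longrightarrow> (a \<circ> q) \<longlonglongrightarrow> l \<Longrightarrow> l = c"
  shows "a \<longlonglongrightarrow> c"
proof (rule ccontr)
  assume "\<not> a \<longlonglongrightarrow> c"
  then obtain e where e: "e > 0" "\<forall>n. \<exists>m\<ge>n. e \<le> dist (a m) c"
    unfolding lim_sequentially by (meson not_le)
  then have "infinite {m. e \<le> dist (a m) c}" unfolding infinite_nat_iff_unbounded_le by auto
  then obtain s :: "nat \<Rightarrow> nat" where s: "strict_mono s" "\<And>n. s n \<in> {m. e \<le> dist (a m) c}"
    using infinite_enumerate by metis
  have "bounded (range (a \<circ> s))" using bdd by (rule bounded_subset) auto
  then obtain l q where q: "strict_mono q" "(a \<circ> s \<circ> q) \<longlonglongrightarrow> l"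
    using bounded_imp_convergent_subsequence by blast
  have "l = c" using sub[of "s \<circ> q" l] q s by (simp add: o_assoc strict_mono_o)
  with q(2) e(1) have "eventually (\<lambda>n. dist ((a \<circ> s \<circ> q) n) c < e) sequentially"
    by (auto dest: tendstoD)
  then obtain n where "dist (a (s (q n))) c < e" by (auto simp: eventually_sequentially)
  with s(2)[of "q n"] show False by simp
qed

section \<open>Subsequences converging against the associate space\<close>

context banach_function_space
begin

text \<open>A limit point of the integrals of \<open>F n * g\<close> is also the limit along
  minimising midpoints of the corresponding subsequence. By maximality and uniqueness these converge
  a.e. to the same \<open>y\<close>, and \<open>AE_limit_weak\<close> identifies the limit point.
  Since \<open>r\<close> and \<open>y\<close> are chosen before \<open>g\<close>, one subsequence
  serves the whole associate space.\<close>

lemma nonneg_weakly_convergent_subseq: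
  fixes f :: "nat \<Rightarrow> real \<Rightarrow> real"
  assumes mc: "monotonically_complete X N" and oc: "associate_order_continuous X N"
    and f: "\<And>n. f n \<in> X" and C: "\<And>n. N (f n) \<le> C" and f0: "\<And>n t. 0 \<le> f n t"
  obtains r y where "strict_mono (r :: nat \<Rightarrow> nat)" "y \<in> X"
    "\<forall>g\<in>associate_space X.
      (\<lambda>n. \<integral>t. f (r n) t * g t \<partial>unit_leb) \<longlonglongrightarrow> (\<integral>t. y t * g t \<partial>unit_leb)"
proof -
  have fn: "nonneg_meas (f n)" for n using meas[OF f] f0 by (simp add: nonneg_meas_def)
  obtain r where r: "strict_mono r"
    and max: "\<forall>r'. strict_mono r' \<longrightarrow> tail_lim (f \<circ> r \<circ> r') \<le> tail_lim (f \<circ> r)"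
    by (rule maximal_subsequence[of f, OF fn])
  define F where "F = f \<circ> r"
  have F: "F n \<in> X" "N (F n) \<le> C" "0 \<le> F n t" "nonneg_meas (F n)" for n t
    using f C f0 fn by (auto simp: F_def)
  obtain w y where w: "\<forall>k. w k \<in> midpoints F k" and y: "y \<in> X"
    and wy: "AE t in unit_leb. (\<lambda>k. w k t) \<longlonglongrightarrow> y t"
    and w_min: "(\<lambda>k. exp_mean (w k)) \<longlonglongrightarrow> tail_lim F"
    by (rule minimising_midpoints_converge[where f = F, OF mc F(1,2,3)])
  show thesis
  proof (rule that[OF r y], rule ballI)
    fix g assume g: "g \<in> associate_space X"
    define a where "a n = (\<integral>t. F n t * g t \<partial>unit_leb)" for n
    obtain B where B: "\<forall>f\<in>X. (\<integral>t. \<bar>f t * g t\<bar> \<partial>unit_leb) \<le> B * N f"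
      using assoc_bounded[OF mc g] by blast
    have "a \<longlonglongrightarrow> (\<integral>t. y t * g t \<partial>unit_leb)"
    proof (rule tendsto_of_convergent_subseqs)
      have "norm (a n) \<le> \<bar>B\<bar> * C" for n
      proof -
        have "norm (a n) \<le> B * N (F n)"
          using order_trans[OF integral_abs_bound bspec[OF B F(1)]] by (simp add: a_def)
        also have "\<dots> \<le> \<bar>B\<bar> * C" using F(2) norm_nonneg[OF F(1)] by (intro mult_mono) auto
        finally show ?thesis .
      qed
      then show "bounded (range a)" by (intro boundedI[of _ "\<bar>B\<bar> * C"]) blast
      fix q :: "nat \<Rightarrow> nat" and l assume q: "strict_mono q" and l: "(a \<circ> q) \<longlonglongrightarrow> l"
      have Fq: "(F \<circ> q) n \<in> X" "N ((F \<circ> q) n) \<le> C" "0 \<le> (F \<circ> q) n t" for n t using F by auto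
      obtain v z where v: "\<forall>k. v k \<in> midpoints (F \<circ> q) k" and z: "z \<in> X"
        and vz: "AE t in unit_leb. (\<lambda>k. v k t) \<longlonglongrightarrow> z t"
        and v_min: "(\<lambda>k. exp_mean (v k)) \<longlonglongrightarrow> tail_lim (F \<circ> q)"
        by (rule minimising_midpoints_converge[where f = "F \<circ> q", OF mc Fq])
      \<comment> \<open>By maximality of \<open>r\<close>, minimising midpoints of the subsequence
        also minimise for \<open>F\<close>, so \<open>minimisers_unique\<close> can compare them
        with \<open>w\<close>.\<close>
      have "tail_lim (F \<circ> q) = tail_lim F"
        unfolding F_def using max q tail_lim_subseq[of F, OF F(4) q] unfolding F_def by (blast intro: antisym)
      with v_min have v_min': "(\<lambda>k. exp_mean (v k)) \<longlonglongrightarrow> tail_lim F" by simp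
      have vF: "v k \<in> midpoints F k" for k using v midpoints_subseq[OF q] by blast
      have zy: "AE t in unit_leb. z t = y t"
        by (rule minimisers_unique[OF F(4) vF v_min' spec[OF w] w_min vz meas[OF z] wy meas[OF y]])
      have vX: "v k \<in> X" "N (v k) \<le> C" for k using midpoints_mem[OF F(1,2) vF] by auto
      have "AE t in unit_leb. (\<lambda>k. v k t) \<longlonglongrightarrow> y t" using vz zy by eventually_elim simp
      then have lim_y: "(\<lambda>k. \<integral>t. v k t * g t \<partial>unit_leb) \<longlonglongrightarrow> (\<integral>t. y t * g t \<partial>unit_leb)"
        by (rule AE_limit_weak[OF mc oc vX y _ g])
      have lim_l: "(\<lambda>k. \<integral>t. v k t * g t \<partial>unit_leb) \<longlonglongrightarrow> l"
      proof (rule metric_LIMSEQ_I)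
        fix e :: real assume e: "e > 0"
        have "0 < e / 2" using e by simp
        from metric_LIMSEQ_D[OF l this] obtain k0 where k0: "\<And>n. n \<ge> k0 \<Longrightarrow> \<bar>a (q n) - l\<bar> < e / 2"
          by (auto simp: dist_real_def)
        \<comment> \<open>The integral against \<open>g\<close> respects midpoints and an interval
          around \<open>l\<close> is convex, so closeness to \<open>l\<close> passes from late terms
          to all their midpoints.\<close>
        have near: "p \<in> X \<and> \<bar>(\<integral>t. p t * g t \<partial>unit_leb) - l\<bar> < e / 2"
          if p: "p \<in> midpoints (F \<circ> q) k0" for p
          using p
        proof induction
          case (base k)
          then show ?case using k0[of k] F(1) by (simp add: a_def)
        next
          case (mid p p')
          then have X: "p \<in> X" "p' \<in> X" by auto
          have "(\<integral>t. (p t + p' t) / 2 * g t \<partial>unit_leb)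
              = (\<integral>t. p t * g t / 2 + p' t * g t / 2 \<partial>unit_leb)"
            by (simp add: field_simps)
          also have "\<dots> = ((\<integral>t. p t * g t \<partial>unit_leb) + (\<integral>t. p' t * g t \<partial>unit_leb)) / 2"
            using assoc_integrable[OF g X(1)] assoc_integrable[OF g X(2)]
            by (simp add: add_divide_distrib)
          finally have eq: "(\<integral>t. (p t + p' t) / 2 * g t \<partial>unit_leb)
              = ((\<integral>t. p t * g t \<partial>unit_leb) + (\<integral>t. p' t * g t \<partial>unit_leb)) / 2" .
          have "\<bar>((\<integral>t. p t * g t \<partial>unit_leb) + (\<integral>t. p' t * g t \<partial>unit_leb)) / 2 - l\<bar> < e / 2"
            using mid.IH by (intro abs_midpoint_less) auto
          then show ?case unfolding eq using divide_mem[OF add_mem[OF X]] by blast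
        qed
        show "\<exists>k0. \<forall>k\<ge>k0. dist (\<integral>t. v k t * g t \<partial>unit_leb) l < e"
        proof (intro exI allI impI)
          fix k assume "k0 \<le> k"
          then have "v k \<in> midpoints (F \<circ> q) k0" using v midpoints_antimono by blast
          with near[of "v k"] e show "dist (\<integral>t. v k t * g t \<partial>unit_leb) l < e"
            by (simp add: dist_real_def)
        qed
      qed
      from LIMSEQ_unique[OF lim_l lim_y] show "l = (\<integral>t. y t * g t \<partial>unit_leb)" .
    qed
    then show "(\<lambda>n. \<integral>t. f (r n) t * g t \<partial>unit_leb) \<longlonglongrightarrow> (\<integral>t. y t * g t \<partial>unit_leb)"
      by (simp add: a_def[abs_def] F_def)
  qed
qed

text \<open>The nonnegative case is applied to the positive parts, and then to the negative parts
  along the subsequence already found.\<close>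

lemma weakly_convergent_subseq:
  fixes f :: "nat \<Rightarrow> real \<Rightarrow> real"
  assumes mc: "monotonically_complete X N" and oc: "associate_order_continuous X N"
    and f: "\<And>n. f n \<in> X" and C: "\<And>n. N (f n) \<le> C"
  obtains s y where "strict_mono (s :: nat \<Rightarrow> nat)" "y \<in> X"
    "\<forall>g\<in>associate_space X.
      (\<lambda>n. \<integral>t. f (s n) t * g t \<partial>unit_leb) \<longlonglongrightarrow> (\<integral>t. y t * g t \<partial>unit_leb)"
proof -
  define p where "p n = (\<lambda>t. max 0 (f n t))" for n
  define m where "m n = (\<lambda>t. max 0 (- f n t))" for n
  have p: "p n \<in> X" "N (p n) \<le> C" "0 \<le> p n t" for n t
    using pos_part_mem(1)[OF f] order_trans[OF pos_part_mem(2)[OF f] C] by (auto simp: p_def)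
  have Nneg: "N (\<lambda>t. - f n t) \<le> C" for n using norm_scale[OF f, of "-1"] C by simp
  have m: "m n \<in> X" "N (m n) \<le> C" "0 \<le> m n t" for n t
    using pos_part_mem(1)[OF uminus_mem[OF f]]
      order_trans[OF pos_part_mem(2)[OF uminus_mem[OF f]] Nneg] by (auto simp: m_def)
  obtain r y where r: "strict_mono (r :: nat \<Rightarrow> nat)" and y: "y \<in> X" and ry:
    "\<forall>g\<in>associate_space X.
      (\<lambda>n. \<integral>t. p (r n) t * g t \<partial>unit_leb) \<longlonglongrightarrow> (\<integral>t. y t * g t \<partial>unit_leb)"
    by (rule nonneg_weakly_convergent_subseq[where f = p, OF mc oc p])
  obtain q z where q: "strict_mono (q :: nat \<Rightarrow> nat)" and z: "z \<in> X" and qz: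
    "\<forall>g\<in>associate_space X.
      (\<lambda>n. \<integral>t. m (r (q n)) t * g t \<partial>unit_leb) \<longlonglongrightarrow> (\<integral>t. z t * g t \<partial>unit_leb)"
    by (rule nonneg_weakly_convergent_subseq[where f = "\<lambda>n. m (r n)", OF mc oc m])
  show thesis
  proof (rule that[OF strict_mono_o[OF r q] diff_mem[OF y z]], rule ballI)
    fix g assume g: "g \<in> associate_space X"
    have split: "f n t = p n t - m n t" for n t by (auto simp: p_def m_def)
    have "(\<lambda>n. (\<integral>t. p (r (q n)) t * g t \<partial>unit_leb) - (\<integral>t. m (r (q n)) t * g t \<partial>unit_leb))
        \<longlonglongrightarrow> (\<integral>t. y t * g t \<partial>unit_leb) - (\<integral>t. z t * g t \<partial>unit_leb)"
      using LIMSEQ_subseq_LIMSEQ[OF bspec[OF ry g] q] bspec[OF qz g] by (intro tendsto_diff) (auto simp: comp_def)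
    then show "(\<lambda>n. \<integral>t. f ((r \<circ> q) n) t * g t \<partial>unit_leb)
        \<longlonglongrightarrow> (\<integral>t. (y t - z t) * g t \<partial>unit_leb)"
      using assoc_integrable[OF g p(1)] assoc_integrable[OF g m(1)] assoc_integrable[OF g y]
        assoc_integrable[OF g z] by (simp add: split left_diff_distrib)
  qed
qed

section \<open>Passing between the two order Banach-Saks properties\<close>

text \<open>Subtracting the weak limit \<open>y\<close> of a subsequence leaves a bounded null
  sequence for the associate space; adding \<open>y\<close> back to the order limit of its Cesaro
  means settles the original sequence.\<close>

lemma associate_oBSP_imp_oBSP:
  assumes mc: "monotonically_complete X N" and oc: "associate_order_continuous X N"
    and bs: "associate_oBSP X N"
  shows "oBSP X N"
  unfolding oBSP_def
proof (intro allI impI)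
  fix f assume "norm_bounded_seq X N f"
  then obtain C where f: "\<And>n. f n \<in> X" and C: "\<And>n. N (f n) \<le> C"
    by (auto simp: norm_bounded_seq_def)
  obtain s y where s: "strict_mono (s :: nat \<Rightarrow> nat)" and y: "y \<in> X" and sy:
    "\<forall>g\<in>associate_space X.
      (\<lambda>n. \<integral>t. f (s n) t * g t \<partial>unit_leb) \<longlonglongrightarrow> (\<integral>t. y t * g t \<partial>unit_leb)"
    by (rule weakly_convergent_subseq[where f = f, OF mc oc f C])
  define F where "F n = (\<lambda>t. f (s n) t - y t)" for n
  have F: "F n \<in> X" for n unfolding F_def by (intro diff_mem f y)
  have "N (F n) \<le> C + N y" for n
    using norm_triangle[OF f scale_mem[OF y, of "-1"], of "s n"] norm_scale[OF y, of "-1"] C[of "s n"]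
    by (simp add: F_def)
  with F have "norm_bounded_seq X N F" by (auto simp: norm_bounded_seq_def)
  moreover have "associate_null X F"
    unfolding associate_null_def
  proof
    fix g assume g: "g \<in> associate_space X"
    have "(\<integral>t. F n t * g t \<partial>unit_leb)
        = (\<integral>t. f (s n) t * g t \<partial>unit_leb) - (\<integral>t. y t * g t \<partial>unit_leb)" for n
      using assoc_integrable[OF g f] assoc_integrable[OF g y] by (simp add: F_def left_diff_distrib)
    with LIM_zero[OF bspec[OF sy g]] show "(\<lambda>n. \<integral>t. F n t * g t \<partial>unit_leb) \<longlonglongrightarrow> 0" by simp
  qed
  ultimately obtain q l where q: "strict_mono (q :: nat \<Rightarrow> nat)" and l: "l \<in> X"
    and conv: "order_converges X (cesaro (F \<circ> q)) l"
    using bs unfolding associate_oBSP_def has_order_cesaro_subseq_def by blast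
  define l' where "l' = (\<lambda>t. l t + y t)"
  have l': "l' \<in> X" unfolding l'_def by (intro add_mem l y)
  \<comment> \<open>Subtracting \<open>y\<close> from every term lowers each mean by exactly
    \<open>y\<close>, so the errors coincide and the same dominating sequence works.\<close>
  have eq: "cesaro (f \<circ> (s \<circ> q)) n t - l' t = cesaro (F \<circ> q) n t - l t" for n t
  proof -
    have "(\<Sum>k\<le>n. F (q k) t) = (\<Sum>k\<le>n. f (s (q k)) t) - real (Suc n) * y t"
      by (simp add: F_def sum_subtractf)
    then show ?thesis by (simp add: cesaro_def l'_def diff_divide_distrib del: of_nat_Suc)
  qed
  have "cesaro (f \<circ> (s \<circ> q)) n \<in> X" for n
    unfolding cesaro_def by (intro divide_mem sum_mem) (simp add: f)
  with conv l' have "order_converges X (cesaro (f \<circ> (s \<circ> q))) l'"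
    unfolding order_converges_def eq by blast
  with l' strict_mono_o[OF s q] show "has_order_cesaro_subseq X f"
    unfolding has_order_cesaro_subseq_def by blast
qed

lemma oBSP_imp_associate_oBSP: "oBSP X N \<Longrightarrow> associate_oBSP X N"
  by (auto simp: oBSP_def associate_oBSP_def)

end

theorem theorem2p2:
  fixes X :: "(real \<Rightarrow> real) set" and N :: "(real \<Rightarrow> real) \<Rightarrow> real"
  assumes "banach_function_space X N"
  shows "(oBSP X N \<longleftrightarrow>
            monotonically_complete X N \<and> norm_dual_order_continuous X N \<and> associate_oBSP X N) \<and>
         (oBSP X N \<longleftrightarrow>
            monotonically_complete X N \<and> associate_order_continuous X N \<and> associate_oBSP X N)"
proof -
  interpret banach_function_space X N by (rule assms)
  \<comment> \<open>The conditions form a cycle: oBSP yields the version with the norm dual, this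
    yields the version with the associate space, and that returns to oBSP.\<close>
  show ?thesis
    using oBSP_imp_monotonically_complete oBSP_imp_norm_dual_oc oBSP_imp_associate_oBSP
      norm_dual_oc_imp_associate_oc associate_oBSP_imp_oBSP by blast
qed

end
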